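(* Let $(\xi_t)_{t\ge0}$ be the Ornstein–Uhlenbeck process $d\xi_t=\theta\xi_t\,dt+dw_t$ with unknown parameter $\theta\le0$, where $(w_t)_{t\ge0}$ is a standard Brownian motion, $\xi_0\sim\mathcal N(0,1/(2|\theta|))$ if $\theta<0$, and $\xi_0=0$ if $\theta=0$. Let $y$ be given by $dy_t=S(t)\,dt+d\xi_t$. Then, for any $\theta\le0$, the least squares model selection procedure $\widehat S_{\widehat m}$ constructed with $\lambda^*=2$ satisfies $$\mathbf{E}_S\|\widehat S_{\widehat m}-S\|^2\le\inf_{m\in\mathcal M}\widehat b_m(S)+\frac{2\tau_0}{n},$$ where $$\widehat b_m(S)=3\|S_m-S\|^2+2\tau_1\frac{d_ml_m}{n},\qquad \tau_0=\frac{16\,l^*z_*}{z_*-1},\qquad\tau_1=3+16z_*.$$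
   Context: $S$ is an unknown $1$-periodic function, square integrable on $[0,1]$. The process $(y_t)_{0\le t\le n}$ is observed, with $n\ge1$ fixed. $\mathbf{E}_S$ denotes expectation with respect to the distribution of the observed process given $S$. The initial value $\xi_0$ is independent of $w$. $\mathcal X$ is the Hilbert space of square integrable $1$-periodic functions on $\mathbb R$ with $(x,y)=\int_0^1x(t)y(t)\,dt$ and $\|x\|^2=(x,x)$. $(\phi_j)_{j\ge1}$ is an orthonormal system in $\mathcal X$. $\mathcal M$ is a finite set of finite subsets of $\mathbb N=\{1,2,\ldots\}$. For $m\in\mathcal M$, $d_m$ is the number of elements of $m$ and $S_m=\sum_{j\in m}(S,\phi_j)\phi_j$. The weights $(l_m)_{m\in\mathcal M}$ satisfy $l_m\ge1$, and $l^*=\sum_{m\in\mathcal M}e^{-l_md_m}$. The number $z_*$ is the maximal root of $\ln z=z-2$ ($z_*\approx3.1462$). The penalty is $P_n(m)=\rho\,\frac{l_md_m}{n}$ with $\rho=4\lambda^*\frac{z_*^2}{z_*-1}$; here $\lambda^*=2$. The contrast is $\gamma_n(x)=\|x\|^2-\frac2n\int_0^nx(t)\,dy_t$ (extended by linearity of the integral to finite combinations of the $\phi_j$ with random coefficients). The least squares estimators are $\widehat S_m=\sum_{j\in m}\widehat\alpha_j\phi_j$ with $\widehat\alpha_j=\frac1n\int_0^n\phi_j(t)\,dy_t$, and $\widehat m=\operatorname{argmin}_{m\in\mathcal M}\{\gamma_n(\widehat S_m)+P_n(m)\}$. *)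

theory Defs
  imports "HOL-Probability.Probability"
begin

section \<open>The space of square integrable 1-periodic functions\<close>

text \<open>
  Functions that agree almost everywhere are not identified; the form below is
  the inner product of the quotient space evaluated on representatives.
\<close>

definition periodic_L2 :: "(real \<Rightarrow> real) \<Rightarrow> bool" where
  "periodic_L2 x \<longleftrightarrow>
     x \<in> borel_measurable lebesgue \<and>
     (\<forall>t. x (t + 1) = x t) \<and>
     set_integrable lebesgue {0..1} (\<lambda>t. (x t)\<^sup>2)"

definition inner_L2 :: "(real \<Rightarrow> real) \<Rightarrow> (real \<Rightarrow> real) \<Rightarrow> real" where
  "inner_L2 x z = (LINT t:{0..1}|lebesgue. x t * z t)"

definition normsq_L2 :: "(real \<Rightarrow> real) \<Rightarrow> real" where
  "normsq_L2 x = inner_L2 x x"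

text \<open>The index set of the system is $\{1, 2, \ldots\}$; the function at index 0 is unconstrained.\<close>

definition orthonormal_system :: "(nat \<Rightarrow> real \<Rightarrow> real) \<Rightarrow> bool" where
  "orthonormal_system \<phi> \<longleftrightarrow>
     (\<forall>j\<ge>1. periodic_L2 (\<phi> j)) \<and>
     (\<forall>i\<ge>1. \<forall>j\<ge>1. inner_L2 (\<phi> i) (\<phi> j) = (if i = j then 1 else 0))"


section \<open>Brownian motion and the Ornstein--Uhlenbeck process\<close>

text \<open>Processes are indexed by all reals; only their values at times $t \ge 0$ matter.\<close>

definition standard_brownian_motion :: "'a measure \<Rightarrow> (real \<Rightarrow> 'a \<Rightarrow> real) \<Rightarrow> bool" where
  "standard_brownian_motion M w \<longleftrightarrow>
     prob_space M \<and>
     (\<forall>t\<ge>0. w t \<in> borel_measurable M) \<and>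
     (AE \<omega> in M. w 0 \<omega> = 0) \<and>
     (AE \<omega> in M. continuous_on {0..} (\<lambda>t. w t \<omega>)) \<and>
     (\<forall>s t. 0 \<le> s \<and> s < t \<longrightarrow>
        distributed M lborel (\<lambda>\<omega>. w t \<omega> - w s \<omega>) (normal_density 0 (sqrt (t - s)))) \<and>
     (\<forall>(k::nat) t. 0 \<le> t 0 \<and> (\<forall>i<k. t i < t (Suc i)) \<longrightarrow>
        prob_space.indep_vars M (\<lambda>_. borel) (\<lambda>i \<omega>. w (t (Suc i)) \<omega> - w (t i) \<omega>) {..<k})"

definition ornstein_uhlenbeck ::
    "'a measure \<Rightarrow> real \<Rightarrow> (real \<Rightarrow> 'a \<Rightarrow> real) \<Rightarrow> (real \<Rightarrow> 'a \<Rightarrow> real) \<Rightarrow> bool" where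
  "ornstein_uhlenbeck M \<theta> w \<xi> \<longleftrightarrow>
     (\<forall>t\<ge>0. \<xi> t \<in> borel_measurable M) \<and>
     prob_space.indep_set M
       (sets (vimage_algebra (space M) (\<xi> 0) borel))
       (sets (vimage_algebra (space M) (\<lambda>\<omega>. \<lambda>t\<in>{0..}. w t \<omega>) (Pi\<^sub>M {0..} (\<lambda>_. borel)))) \<and>
     (if \<theta> = 0 then AE \<omega> in M. \<xi> 0 \<omega> = 0
      else distributed M lborel (\<xi> 0) (normal_density 0 (sqrt (1 / (2 * \<bar>\<theta>\<bar>))))) \<and>
     (AE \<omega> in M. continuous_on {0..} (\<lambda>t. \<xi> t \<omega>) \<and>
        (\<forall>t\<ge>0. \<xi> t \<omega> = \<xi> 0 \<omega> + \<theta> * (LINT s:{0..t}|lborel. \<xi> s \<omega>) + w t \<omega>))"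

text \<open>The integrated form of $dy_t = S(t)\,dt + d\xi_t$ on $[0,T]$. The initial value of
  the observed process is left free, since only its increments are used.\<close>

definition observation ::
    "'a measure \<Rightarrow> real \<Rightarrow> (real \<Rightarrow> real) \<Rightarrow> (real \<Rightarrow> 'a \<Rightarrow> real) \<Rightarrow> (real \<Rightarrow> 'a \<Rightarrow> real) \<Rightarrow> bool" where
  "observation M T S \<xi> y \<longleftrightarrow>
     (\<forall>t\<in>{0..T}. y t \<in> borel_measurable M) \<and>
     (AE \<omega> in M. \<forall>t\<in>{0..T}.
        y t \<omega> = y 0 \<omega> + (LINT s:{0..t}|lebesgue. S s) + (\<xi> t \<omega> - \<xi> 0 \<omega>))"


section \<open>Stochastic integrals of deterministic functions\<close>

text \<open>
  A list of triples $(c,a,b)$ encodes the step function $\sum c\,1_{(a,b]}$, whose integral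
  against a process $y$ is $\sum c\,(y_b - y_a)$. Overlapping intervals are allowed; by
  linearity the integral depends only on the step function.
\<close>

definition step_fun :: "(real \<times> real \<times> real) list \<Rightarrow> real \<Rightarrow> real" where
  "step_fun X t = (\<Sum>(c, a, b)\<leftarrow>X. c * indicator {a<..b} t)"

definition step_integral ::
    "(real \<times> real \<times> real) list \<Rightarrow> (real \<Rightarrow> 'a \<Rightarrow> real) \<Rightarrow> 'a \<Rightarrow> real" where
  "step_integral X y \<omega> = (\<Sum>(c, a, b)\<leftarrow>X. c * (y b \<omega> - y a \<omega>))"

text \<open>
  The random variable \<open>I\<close> is a version of $\int_0^T f(t)\,dy_t$: step functions tend to \<open>f\<close>
  in $L^2[0,T]$ and their integrals tend to \<open>I\<close> in $L^2(P)$. If $dy_t = S(t)\,dt + d\xi_t$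
  with $S$ in $L^2[0,T]$ and $\xi$ an Ornstein--Uhlenbeck process as above, then the
  mean square of the integral of a step function $g$ is at most a constant multiple of
  $\int_0^T g^2$. Hence a version exists for every $f$ in $L^2[0,T]$, it is almost surely unique,
  and it equals $\int_0^T f S\,dt + \theta \int_0^T f \xi\,dt + \int_0^T f\,dw$.
\<close>

definition has_stochastic_integral ::
    "'a measure \<Rightarrow> (real \<Rightarrow> 'a \<Rightarrow> real) \<Rightarrow> real \<Rightarrow> (real \<Rightarrow> real) \<Rightarrow> ('a \<Rightarrow> real) \<Rightarrow> bool" where
  "has_stochastic_integral M y T f I \<longleftrightarrow>
     f \<in> borel_measurable lebesgue \<and>
     I \<in> borel_measurable M \<and>
     (\<exists>X. (\<forall>k. \<forall>(c, a, b)\<in>set (X k). 0 \<le> a \<and> a \<le> b \<and> b \<le> T) \<and>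
       (\<lambda>k::nat. \<integral>\<^sup>+t\<in>{0..T}. ennreal ((step_fun (X k) t - f t)\<^sup>2) \<partial>lebesgue)
         \<longlonglongrightarrow> 0 \<and>
       (\<lambda>k::nat. \<integral>\<^sup>+\<omega>. ennreal ((step_integral (X k) y \<omega> - I \<omega>)\<^sup>2) \<partial>M)
         \<longlonglongrightarrow> 0)"


section \<open>Model selection\<close>

text \<open>
  In this section \<open>J j\<close> stands for a version of $\int_0^n \phi_j(t)\,dy_t$, the only
  feature of the observations that enters the procedure.
\<close>

definition proj_on :: "(nat \<Rightarrow> real \<Rightarrow> real) \<Rightarrow> (real \<Rightarrow> real) \<Rightarrow> nat set \<Rightarrow> real \<Rightarrow> real" where
  "proj_on \<phi> S m t = (\<Sum>j\<in>m. inner_L2 S (\<phi> j) * \<phi> j t)"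

definition alpha_hat :: "nat \<Rightarrow> (nat \<Rightarrow> 'a \<Rightarrow> real) \<Rightarrow> nat \<Rightarrow> 'a \<Rightarrow> real" where
  "alpha_hat n J j \<omega> = J j \<omega> / real n"

definition S_hat ::
    "nat \<Rightarrow> (nat \<Rightarrow> real \<Rightarrow> real) \<Rightarrow> (nat \<Rightarrow> 'a \<Rightarrow> real) \<Rightarrow> nat set \<Rightarrow> 'a \<Rightarrow> real \<Rightarrow> real" where
  "S_hat n \<phi> J m \<omega> t = (\<Sum>j\<in>m. alpha_hat n J j \<omega> * \<phi> j t)"

text \<open>The contrast $\gamma_n(x) = \|x\|^2 - \frac2n \int_0^n x(t)\,dy_t$ at
  $x = \sum_{j\in m} c_j \phi_j$, the integral being extended linearly to coefficients
  \<open>c\<close> that may depend on \<open>\<omega>\<close>.\<close>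

definition contrast ::
    "nat \<Rightarrow> (nat \<Rightarrow> real \<Rightarrow> real) \<Rightarrow> (nat \<Rightarrow> 'a \<Rightarrow> real) \<Rightarrow> nat set \<Rightarrow> (nat \<Rightarrow> real) \<Rightarrow> 'a \<Rightarrow> real" where
  "contrast n \<phi> J m c \<omega> =
     normsq_L2 (\<lambda>t. \<Sum>j\<in>m. c j * \<phi> j t) - 2 / real n * (\<Sum>j\<in>m. c j * J j \<omega>)"

definition z_star :: real where
  "z_star = (GREATEST z. 0 < z \<and> ln z = z - 2)"

definition rho :: "real \<Rightarrow> real" where
  "rho lambda_star = 4 * lambda_star * (z_star\<^sup>2 / (z_star - 1))"

definition penalty :: "real \<Rightarrow> nat \<Rightarrow> (nat set \<Rightarrow> real) \<Rightarrow> nat set \<Rightarrow> real" where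
  "penalty lambda_star n l m = rho lambda_star * (l m * real (card m) / real n)"

text \<open>Ties in the minimisation may be broken in any measurable way.\<close>

definition selects_model ::
    "'a measure \<Rightarrow> real \<Rightarrow> nat \<Rightarrow> (nat \<Rightarrow> real \<Rightarrow> real) \<Rightarrow> (nat \<Rightarrow> 'a \<Rightarrow> real) \<Rightarrow>
     nat set set \<Rightarrow> (nat set \<Rightarrow> real) \<Rightarrow> ('a \<Rightarrow> nat set) \<Rightarrow> bool" where
  "selects_model M lambda_star n \<phi> J \<M> l mhat \<longleftrightarrow>
     mhat \<in> measurable M (count_space \<M>) \<and>
     (\<forall>\<omega>\<in>space M. is_arg_min
        (\<lambda>m. contrast n \<phi> J m (\<lambda>j. alpha_hat n J j \<omega>) \<omega> + penalty lambda_star n l m)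
        (\<lambda>m. m \<in> \<M>) (mhat \<omega>))"

definition l_star :: "nat set set \<Rightarrow> (nat set \<Rightarrow> real) \<Rightarrow> real" where
  "l_star \<M> l = (\<Sum>m\<in>\<M>. exp (- l m * real (card m)))"

definition tau0 :: "nat set set \<Rightarrow> (nat set \<Rightarrow> real) \<Rightarrow> real" where
  "tau0 \<M> l = 16 * l_star \<M> l * z_star / (z_star - 1)"

definition tau1 :: real where
  "tau1 = 3 + 16 * z_star"

definition b_hat ::
    "nat \<Rightarrow> (nat \<Rightarrow> real \<Rightarrow> real) \<Rightarrow> (nat set \<Rightarrow> real) \<Rightarrow> (real \<Rightarrow> real) \<Rightarrow> nat set \<Rightarrow> real" where
  "b_hat n \<phi> l S m =
     3 * normsq_L2 (\<lambda>t. proj_on \<phi> S m t - S t) + 2 * tau1 * (real (card m) * l m / real n)"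

end

theory Submission
  imports Defs
begin

text \<open>
  Write $\widehat\alpha_j = (S,\phi_j) + x_j/\sqrt n$. The whole probabilistic input is that, for the
  Ornstein--Uhlenbeck noise, $E \exp(\int f\,d\xi) \le \exp(\frac12 \int f^2)$, i.e. the noise
  integrals are dominated by those of white noise. For a step function on the grid $k/N$,
  summation by parts along the recursion $\xi_{k+1} - \xi_k = \theta\xi_k/N + \Delta w_k + o(1/N)$ turns
  $\sum_k g_k (\xi_{k+1} - \xi_k)$ into a combination of the independent variables $\xi_0$ and
  $\Delta w_k$, up to a vanishing remainder, and its variance is bounded by an energy estimate.
  Two applications of Fatou's lemma carry the bound to the stochastic integral.

  The selection inequality then gives, for every fixed model $m$,
  \[ \|\widehat S_{\widehat m} - S\|^2 \le 3\|S_m - S\|^2 + 2P_n(m) - 2P_n(\widehat m)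
     + \frac1n \Bigl(3 \sum_{j \in \widehat m} x_j^2 + 4 Z_{\widehat m}^2\Bigr), \]
  where $Z_{m'}$ is the noise in the unit direction of $S_{m'} - S_m$. The penalty at $\widehat m$ absorbs the
  quadratic terms up to their excesses over multiples of $l_{m'} d_{m'}$, which are summed over all models $m'$
  and have expectation of order $e^{-l_{m'} d_{m'}}/n$ by Chernoff bounds.
\<close>

section \<open>Riemann sums of step functions\<close>

text \<open>White noise dominates because, for \<theta> < 0, the stationary noise d\<xi> has
  spectral density u^2 / (u^2 + \<theta>^2) \<le> 1 relative to dw. The energy estimate is the
  discrete, finite-horizon form of this fact, so no constant depends on \<theta>. The variables x_j
  are in general correlated, but their covariance is never computed: a bound on the exponential
  moments of all linear combinations survives limits and suffices for every later estimate. The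
  selected model depends on the noise, whereas for a fixed m' the direction of S_{m'} - S_m is
  deterministic. Hence the cross term acts like one Gaussian variable and costs no factor in the
  dimension; only the sum of squares costs 2^{d/2}. Budget, with p = l d: twice the penalty is at
  least 64 p / n, of which 34 = 3 * 6 + 4 * 4 is spent. The thresholds 6 p for the sum of squares
  and 4 p for Z^2 leave excesses of at most 12 e^{-p} / n and 24 e^{-p} / n, and 12 + 24 = 36 \<le>
  32 z / (z - 1) for z = \<open>z_star\<close>.\<close>

text \<open>
  Backwards in time, $B_k = (1 - \kappa D) B_{k+1} - D g_k$ and $h_k = g_k + \kappa B_{k+1}$; the coefficient of $x_0$
  is written as $\kappa B$ so that the case $\kappa = 0$ needs no separate treatment. With $b = \kappa B_{k+1}$ and
  $d = \kappa D$, the energy lost in one step is $D (1 - d) (b - d g_k / (1 - d))^2$.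
\<close>

lemma ar_summation_by_parts:
  fixes g :: "nat \<Rightarrow> real" and \<kappa> D G :: real
  assumes "0 \<le> \<kappa>" "0 < D" "\<kappa> * D < 1" and "\<And>k. \<bar>g k\<bar> \<le> G"
  shows "\<exists>B h. \<bar>B\<bar> \<le> real N * D * G \<and> (\<forall>k<N. \<bar>h k\<bar> \<le> G * (1 + \<kappa> * (real N * D))) \<and>
    \<kappa> * B\<^sup>2 + D * (\<Sum>k<N. (h k)\<^sup>2) \<le> D / (1 - \<kappa> * D) * (\<Sum>k<N. (g k)\<^sup>2) \<and>
    (\<forall>x e. (\<forall>k<N. x (Suc k) - x k = e k - \<kappa> * D * x k) \<longrightarrow>
      (\<Sum>k<N. g k * (x (Suc k) - x k)) = \<kappa> * B * x 0 + (\<Sum>k<N. h k * e k))"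
  using assms(4)
\<comment> \<open>The recursion runs backwards in time: the step peels off index 0 and applies the
  hypothesis to the shifted weights.\<close>
proof (induction N arbitrary: g)
  case 0
  then show ?case by (intro exI[of _ 0]) auto
next
  case (Suc N)
  define a where "a = 1 - \<kappa> * D"
  have a: "0 < a" "a \<le> 1" using assms unfolding a_def by auto
  have G: "0 \<le> G" using Suc.prems[of 0] by linarith
  obtain B' h' where B': "\<bar>B'\<bar> \<le> real N * D * G"
    and h': "\<And>k. k < N \<Longrightarrow> \<bar>h' k\<bar> \<le> G * (1 + \<kappa> * (real N * D))"
    and en: "\<kappa> * B'\<^sup>2 + D * (\<Sum>k<N. (h' k)\<^sup>2) \<le> D / a * (\<Sum>k<N. (g (Suc k))\<^sup>2)"
    and rep: "\<And>x e. (\<And>k. k < N \<Longrightarrow> x (Suc k) - x k = e k - \<kappa> * D * x k) \<Longrightarrow>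
      (\<Sum>k<N. g (Suc k) * (x (Suc k) - x k)) = \<kappa> * B' * x 0 + (\<Sum>k<N. h' k * e k)"
    using Suc.IH[of "\<lambda>k. g (Suc k)"] Suc.prems unfolding a_def by blast
  define B where "B = a * B' - D * g 0"
  define h where "h k = (case k of 0 \<Rightarrow> g 0 + \<kappa> * B' | Suc k \<Rightarrow> h' k)" for k
  have h0: "h 0 = g 0 + \<kappa> * B'" and hS: "h (Suc k) = h' k" for k by (simp_all add: h_def)
  have "\<bar>B\<bar> \<le> \<bar>a * B'\<bar> + \<bar>D * g 0\<bar>" unfolding B_def by linarith
  also have "\<bar>a * B'\<bar> \<le> 1 * (real N * D * G)"
    unfolding abs_mult using a B' by (intro mult_mono) auto
  also have "\<bar>D * g 0\<bar> \<le> D * G" using Suc.prems[of 0] assms by (simp add: abs_mult)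
  finally have 1: "\<bar>B\<bar> \<le> real (Suc N) * D * G" by (simp add: algebra_simps)
  have 2: "\<bar>h k\<bar> \<le> G * (1 + \<kappa> * (real (Suc N) * D))" if "k < Suc N" for k
  proof -
    have mono: "G * (1 + \<kappa> * (real N * D)) \<le> G * (1 + \<kappa> * (real (Suc N) * D))"
      using G assms by (intro mult_left_mono add_left_mono) (auto simp: algebra_simps)
    show ?thesis
    proof (cases k)
      case 0
      have "\<bar>h 0\<bar> \<le> \<bar>g 0\<bar> + \<kappa> * \<bar>B'\<bar>"
        using assms(1) unfolding h0 by (metis abs_mult abs_of_nonneg abs_triangle_ineq)
      also have "\<dots> \<le> G + \<kappa> * (real N * D * G)"
        using Suc.prems[of 0] B' assms(1) by (intro add_mono mult_left_mono) auto
      also have "\<dots> = G * (1 + \<kappa> * (real N * D))" by (simp add: algebra_simps)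
      finally show ?thesis using mono 0 by simp
    next
      case (Suc k')
      then show ?thesis using h'[of k'] mono that by (simp add: hS)
    qed
  qed
  have step: "\<kappa> * B\<^sup>2 + D * (h 0)\<^sup>2 \<le> \<kappa> * B'\<^sup>2 + D / a * (g 0)\<^sup>2"
  proof -
    define b where "b = \<kappa> * B'"
    define d where "d = \<kappa> * D"
    have ad: "a = 1 - d" by (simp add: a_def d_def)
    have "\<kappa> * B'\<^sup>2 + D / a * (g 0)\<^sup>2 - (\<kappa> * B\<^sup>2 + D * (h 0)\<^sup>2)
       = D * ((g 0)\<^sup>2 / a + a * b\<^sup>2 - 2 * d * b * g 0 - (1 + d) * (g 0)\<^sup>2)"
      unfolding B_def h0 b_def ad d_def by (simp add: power2_eq_square algebra_simps)
    also have "(g 0)\<^sup>2 / a + a * b\<^sup>2 - 2 * d * b * g 0 - (1 + d) * (g 0)\<^sup>2 = a * (b - d * g 0 / a)\<^sup>2"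
    proof -
      have "(g 0)\<^sup>2 / a = (1 + d) * (g 0)\<^sup>2 + (d * g 0)\<^sup>2 / a"
      proof -
        have "(g 0)\<^sup>2 = a * ((1 + d) * (g 0)\<^sup>2) + (d * g 0)\<^sup>2"
          unfolding ad by (simp add: power2_eq_square algebra_simps)
        then have "(g 0)\<^sup>2 / a = (a * ((1 + d) * (g 0)\<^sup>2) + (d * g 0)\<^sup>2) / a" by simp
        then show ?thesis using a by (simp add: add_divide_distrib)
      qed
      moreover have "a * (b - d * g 0 / a)\<^sup>2 = a * b\<^sup>2 - 2 * d * b * g 0 + (d * g 0)\<^sup>2 / a"
        using a by (simp add: power2_eq_square field_simps)
      ultimately show ?thesis by linarith
    qed
    also have "D * \<dots> \<ge> 0" using a assms by simp
    finally show ?thesis by simp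
  qed
  have 3: "\<kappa> * B\<^sup>2 + D * (\<Sum>k<Suc N. (h k)\<^sup>2) \<le> D / (1 - \<kappa> * D) * (\<Sum>k<Suc N. (g k)\<^sup>2)"
    using step en unfolding sum.lessThan_Suc_shift hS a_def[symmetric]
    by (simp add: distrib_left)
  have 4: "(\<Sum>k<Suc N. g k * (x (Suc k) - x k)) = \<kappa> * B * x 0 + (\<Sum>k<Suc N. h k * e k)"
    if x: "\<forall>k<Suc N. x (Suc k) - x k = e k - \<kappa> * D * x k" for x e :: "nat \<Rightarrow> real"
  proof -
    have r: "(\<Sum>k<N. g (Suc k) * (x (Suc (Suc k)) - x (Suc k))) = \<kappa> * B' * x (Suc 0) + (\<Sum>k<N. h' k * e (Suc k))"
      using rep[of "\<lambda>k. x (Suc k)" "\<lambda>k. e (Suc k)"] x by simp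
    have x1: "x (Suc 0) = x 0 + e 0 - \<kappa> * D * x 0" using x[rule_format, of 0] by simp
    show ?thesis unfolding sum.lessThan_Suc_shift hS r h0 x1 B_def a_def
      by (simp add: algebra_simps)
  qed
  show ?case using 1 2 3 4 by blast
qed

text \<open>Sampling at the right end of each cell fits intervals open on the left: (k + 1) / N lies
  in (a, b] exactly when floor (a N) \<le> k < floor (b N). So the sum telescopes with no boundary
  error.\<close>

lemma indicator_telescope:
  fixes x :: "nat \<Rightarrow> real"
  assumes "N \<ge> 1" "0 \<le> a" "a \<le> b" "b \<le> real n"
  shows "(\<Sum>k<n * N. indicator {a<..b} (real (Suc k) / real N) * (x (Suc k) - x k))
    = x (nat \<lfloor>b * real N\<rfloor>) - x (nat \<lfloor>a * real N\<rfloor>)"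
proof -
  let ?p = "nat \<lfloor>a * real N\<rfloor>" and ?q = "nat \<lfloor>b * real N\<rfloor>"
  have pq: "?p \<le> ?q" using assms by (intro nat_mono floor_mono mult_right_mono) auto
  have "b * real N \<le> real (n * N)" using assms by (simp add: mult_right_mono)
  then have q: "?q \<le> n * N" using assms by linarith
  have iff: "a < real (Suc k) / real N \<and> real (Suc k) / real N \<le> b \<longleftrightarrow> k \<in> {?p..<?q}" for k
  proof -
    have "a < real (Suc k) / real N \<longleftrightarrow> a * real N < real (Suc k)"
      "real (Suc k) / real N \<le> b \<longleftrightarrow> real (Suc k) \<le> b * real N"
      using assms by (simp_all add: field_simps)
    moreover have "a * real N < real (Suc k) \<longleftrightarrow> ?p \<le> k"
      using assms by (simp add: nat_le_iff) linarith
    moreover have "real (Suc k) \<le> b * real N \<longleftrightarrow> k < ?q"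
      using assms by linarith
    ultimately show ?thesis by simp
  qed
  have "(\<Sum>k<n * N. indicator {a<..b} (real (Suc k) / real N) * (x (Suc k) - x k))
    = (\<Sum>k<n * N. if k \<in> {?p..<?q} then x (Suc k) - x k else 0)"
    by (intro sum.cong refl) (use iff in \<open>auto simp: indicator_def\<close>)
  also have "\<dots> = (\<Sum>k\<in>{?p..<?q}. x (Suc k) - x k)"
    using q by (subst sum.inter_restrict[symmetric]) (auto intro!: sum.cong)
  also have "\<dots> = x ?q - x ?p" using pq by (rule sum_Suc_diff')
  finally show ?thesis .
qed

lemma floor_grid_tendsto:
  assumes "0 \<le> a"
  shows "(\<lambda>N. real (nat \<lfloor>a * real N\<rfloor>) / real N) \<longlonglongrightarrow> a"
proof (rule tendsto_sandwich)
  show "(\<lambda>N. a - 1 / real N) \<longlonglongrightarrow> a" by real_asymp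
  show "(\<lambda>N. a) \<longlonglongrightarrow> a" by simp
  show "eventually (\<lambda>N. a - 1 / real N \<le> real (nat \<lfloor>a * real N\<rfloor>) / real N) sequentially"
    using eventually_gt_at_top[of 0]
  proof eventually_elim
    case (elim N)
    have "a * real N - 1 \<le> real (nat \<lfloor>a * real N\<rfloor>)" by linarith
    then have "(a * real N - 1) / real N \<le> real (nat \<lfloor>a * real N\<rfloor>) / real N"
      by (rule divide_right_mono) simp
    then show ?case using elim by (simp add: diff_divide_distrib)
  qed
  show "eventually (\<lambda>N. real (nat \<lfloor>a * real N\<rfloor>) / real N \<le> a) sequentially"
    using eventually_gt_at_top[of 0]
  proof eventually_elim
    case (elim N)
    have "real (nat \<lfloor>a * real N\<rfloor>) \<le> a * real N" using assms by (simp add: of_nat_floor)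
    then show ?case using elim by (simp add: field_simps)
  qed
qed

abbreviation steps_within :: "real \<Rightarrow> (real \<times> real \<times> real) list \<Rightarrow> bool" where
  "steps_within T X \<equiv> \<forall>(c, a, b)\<in>set X. 0 \<le> a \<and> a \<le> b \<and> b \<le> T"

lemma step_fun_Nil [simp]: "step_fun [] t = 0"
  and step_fun_Cons: "step_fun ((c, a, b) # X) t = c * indicator {a<..b} t + step_fun X t"
  by (simp_all add: step_fun_def)

lemma step_integral_Nil [simp]: "step_integral [] y \<omega> = 0"
  and step_integral_Cons: "step_integral ((c, a, b) # X) y \<omega> = c * (y b \<omega> - y a \<omega>) + step_integral X y \<omega>"
  by (simp_all add: step_integral_def)

lemma abs_step_fun_le: "\<exists>G. \<forall>t. \<bar>step_fun X t\<bar> \<le> G"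
proof (induction X)
  case (Cons p X)
  obtain c a b where p: "p = (c, a, b)" by (metis surj_pair)
  obtain G where G: "\<And>t. \<bar>step_fun X t\<bar> \<le> G" using Cons by auto
  have "\<bar>step_fun (p # X) t\<bar> \<le> \<bar>c\<bar> + G" for t
    using G[of t] unfolding p step_fun_Cons by (auto simp: indicator_def)
  then show ?case by blast
qed auto

lemma step_fun_measurable [measurable]: "step_fun X \<in> borel_measurable borel"
proof (induction X)
  case (Cons p X)
  then show ?case by (cases p) (auto simp: step_fun_Cons[abs_def])
next
  case Nil
  then show ?case by (simp add: step_fun_def[abs_def])
qed

text \<open>Each triple telescopes to an increment between two grid points that converge to a and b,
  and continuity of the path at these two times gives the limit.\<close>

lemma grid_sum_tendsto_step_integral:
  assumes "steps_within (real n) X" and "continuous_on {0..} (\<lambda>t. \<xi> t \<omega>)"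
  shows "(\<lambda>N. \<Sum>k<n * N. step_fun X (real (Suc k) / real N) *
      (\<xi> (real (Suc k) / real N) \<omega> - \<xi> (real k / real N) \<omega>)) \<longlonglongrightarrow> step_integral X \<xi> \<omega>"
  using assms(1)
proof (induction X)
  case (Cons p X)
  obtain c a b where p: "p = (c, a, b)" by (metis surj_pair)
  have ab: "0 \<le> a" "a \<le> b" "b \<le> real n" using Cons.prems p by auto
  have lim: "(\<lambda>N. \<xi> (real (nat \<lfloor>s * real N\<rfloor>) / real N) \<omega>) \<longlonglongrightarrow> \<xi> s \<omega>" if "0 \<le> s" for s
    using assms(2) floor_grid_tendsto[OF that]
    by (rule continuous_on_tendsto_compose) (use that in auto)
  have "(\<lambda>N. c * (\<Sum>k<n * N. indicator {a<..b} (real (Suc k) / real N) *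
      (\<xi> (real (Suc k) / real N) \<omega> - \<xi> (real k / real N) \<omega>))) \<longlonglongrightarrow> c * (\<xi> b \<omega> - \<xi> a \<omega>)"
  proof (intro tendsto_mult tendsto_const)
    have "(\<lambda>N. \<xi> (real (nat \<lfloor>b * real N\<rfloor>) / real N) \<omega> - \<xi> (real (nat \<lfloor>a * real N\<rfloor>) / real N) \<omega>)
        \<longlonglongrightarrow> \<xi> b \<omega> - \<xi> a \<omega>"
      using ab by (intro tendsto_diff lim) auto
    then show "(\<lambda>N. (\<Sum>k<n * N. indicator {a<..b} (real (Suc k) / real N) *
      (\<xi> (real (Suc k) / real N) \<omega> - \<xi> (real k / real N) \<omega>))) \<longlonglongrightarrow> \<xi> b \<omega> - \<xi> a \<omega>"
      by (rule Lim_transform_eventually)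
        (use eventually_ge_at_top[of 1] in eventually_elim,
         rule indicator_telescope[where x = "\<lambda>k. \<xi> (real k / real _) \<omega>", symmetric, OF _ ab])
  qed
  moreover have "(\<lambda>N. \<Sum>k<n * N. step_fun X (real (Suc k) / real N) *
      (\<xi> (real (Suc k) / real N) \<omega> - \<xi> (real k / real N) \<omega>)) \<longlonglongrightarrow> step_integral X \<xi> \<omega>"
    using Cons by simp
  ultimately show ?case unfolding p step_fun_Cons step_integral_Cons distrib_right sum.distrib
    by (simp only: sum_distrib_left mult.assoc tendsto_add)
qed simp

section \<open>Products of step functions and Riemann sums of squares\<close>

text \<open>Intersects the intervals pairwise, so that the square of a step function is again one
  and Riemann sums of squares reduce to the linear case. The outer \<open>max\<close> gives an empty
  intersection ordered ends, which preserves \<open>steps_within\<close>.\<close>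

definition step_mult :: "(real \<times> real \<times> real) list \<Rightarrow> (real \<times> real \<times> real) list \<Rightarrow> (real \<times> real \<times> real) list" where
  "step_mult X Y = concat (map (\<lambda>(c, a, b). map (\<lambda>(c', a', b'). (c * c', max a a', max (max a a') (min b b'))) Y) X)"

lemma step_fun_append: "step_fun (X @ Y) t = step_fun X t + step_fun Y t"
  by (simp add: step_fun_def)

lemma step_fun_mult: "step_fun (step_mult X Y) t = step_fun X t * step_fun Y t"
proof (induction X)
  case (Cons p X)
  obtain c a b where p: "p = (c, a, b)" by (metis surj_pair)
  have "step_fun (map (\<lambda>(c', a', b'). (c * c', max a a', max (max a a') (min b b'))) Y) t
     = c * indicator {a<..b} t * step_fun Y t"
    by (induction Y) (auto simp: step_fun_Cons algebra_simps indicator_def)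
  then show ?case using Cons
    by (simp add: p step_mult_def step_fun_append step_fun_Cons algebra_simps)
qed (simp add: step_mult_def)

lemma steps_within_mult: "steps_within T X \<Longrightarrow> steps_within T Y \<Longrightarrow> steps_within T (step_mult X Y)"
  by (fastforce simp: step_mult_def)

lemma step_fun_set_integrable: "set_integrable lebesgue {0..T} (\<lambda>t. step_fun X t * f t)"
  if "set_integrable lebesgue {0..T} f"
proof -
  obtain G where G: "\<And>t. \<bar>step_fun X t\<bar> \<le> G" using abs_step_fun_le by blast
  have m: "step_fun X \<in> borel_measurable lebesgue" by (intro measurable_completion) measurable
  show ?thesis
  proof (rule set_integrable_bound[OF set_integrable_mult_right[OF that, of G]])
    show "set_borel_measurable lebesgue {0..T} (\<lambda>t. step_fun X t * f t)"
      using m that unfolding set_borel_measurable_def set_integrable_def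
      by (auto intro!: borel_measurable_times dest!: borel_measurable_integrable
          simp: mult.left_commute)
    show "AE t in lebesgue. t \<in> {0..T} \<longrightarrow> norm (step_fun X t * f t) \<le> norm (G * f t)"
      using G by (auto simp: abs_mult intro!: mult_right_mono order_trans[OF G abs_ge_self])
  qed
qed

text \<open>The deterministic process t on the one-point sample space is a continuous path whose
  step integral is the Lebesgue integral, so the pathwise limit above applies.\<close>

lemma grid_sum_tendsto_integral_step_fun:
  assumes "steps_within (real n) X"
  shows "(\<lambda>N. 1 / real N * (\<Sum>k<n * N. step_fun X (real (Suc k) / real N)))
    \<longlonglongrightarrow> (LINT t:{0..real n}|lebesgue. step_fun X t)"
proof -
  have "step_integral X (\<lambda>t _. t) () = (LINT t:{0..real n}|lebesgue. step_fun X t)"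
    using assms
  proof (induction X)
    case (Cons p X)
    obtain c a b where p: "p = (c, a, b)" by (metis surj_pair)
    have ab: "0 \<le> a" "a \<le> b" "b \<le> real n" using Cons.prems p by auto
    have one: "set_integrable lebesgue {0..real n} (\<lambda>t. 1::real)"
      unfolding set_integrable_def by simp
    have i1: "set_integrable lebesgue {0..real n} (\<lambda>t. step_fun Y t)" for Y
      using step_fun_set_integrable[OF one, of Y] by simp
    have "(LINT t:{0..real n}|lebesgue. indicator {a<..b} t) = (LINT t|lebesgue. indicator {a<..b} t :: real)"
      unfolding set_lebesgue_integral_def using ab
      by (intro Bochner_Integration.integral_cong refl) (auto simp: indicator_def)
    also have "\<dots> = b - a" using ab by simp
    finally have "(LINT t:{0..real n}|lebesgue. c * indicator {a<..b} t) = c * (b - a)" by simp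
    moreover have "(LINT t:{0..real n}|lebesgue. step_fun (p # X) t)
      = (LINT t:{0..real n}|lebesgue. c * indicator {a<..b} t) + (LINT t:{0..real n}|lebesgue. step_fun X t)"
      unfolding p step_fun_Cons
      using i1[of "[(c, a, b)]"] i1[of X] by (intro set_integral_add) (simp_all add: step_fun_Cons)
    ultimately show ?case using Cons by (auto simp: p step_integral_Cons)
  qed (simp add: set_lebesgue_integral_def)
  moreover have "(\<Sum>k<n * N. step_fun X (real (Suc k) / real N) * (real (Suc k) / real N - real k / real N))
    = 1 / real N * (\<Sum>k<n * N. step_fun X (real (Suc k) / real N))" for N
    by (simp add: sum_distrib_left diff_divide_distrib[symmetric])
  ultimately show ?thesis
    using grid_sum_tendsto_step_integral[OF assms, of "\<lambda>t _. t" "()"] by (simp add: continuous_on_id)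
qed

lemma grid_sum_tendsto_integral_step_fun_square:
  assumes "steps_within (real n) X"
  shows "(\<lambda>N. 1 / real N * (\<Sum>k<n * N. (step_fun X (real (Suc k) / real N))\<^sup>2))
    \<longlonglongrightarrow> (LINT t:{0..real n}|lebesgue. (step_fun X t)\<^sup>2)"
  using grid_sum_tendsto_integral_step_fun[OF steps_within_mult[OF assms assms]]
  by (simp add: step_fun_mult power2_eq_square)

section \<open>Exponential moments of the Ornstein--Uhlenbeck process\<close>

text \<open>The independence of \<xi>_0 from the whole path of w is given for sigma-algebras,
  whereas the product rule speaks of families of independent variables; \<open>case_bool\<close>
  turns the pair into such a family.\<close>

lemma (in prob_space) nn_integral_mult_indep_set:
  fixes f g :: "'a \<Rightarrow> ennreal"
  assumes ind: "indep_set (sets A) (sets B)" and sp: "space A = space M" "space B = space M"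
    and f: "f \<in> borel_measurable A" and g: "g \<in> borel_measurable B"
  shows "(\<integral>\<^sup>+\<omega>. f \<omega> * g \<omega> \<partial>M) = (\<integral>\<^sup>+\<omega>. f \<omega> \<partial>M) * (\<integral>\<^sup>+\<omega>. g \<omega> \<partial>M)"
proof -
  have AB: "sets A \<subseteq> events" "sets B \<subseteq> events"
    using ind unfolding indep_sets2_eq by auto
  have fm: "random_variable borel f" "random_variable borel g"
    using f g AB sp unfolding measurable_def by auto
  have "indep_set {f -` E \<inter> space M |E. E \<in> sets borel} {g -` E \<inter> space M |E. E \<in> sets borel}"
  proof -
    have "{f -` E \<inter> space M |E. E \<in> sets borel} \<subseteq> sets A" "{g -` E \<inter> space M |E. E \<in> sets borel} \<subseteq> sets B"
      using measurable_sets[OF f] measurable_sets[OF g] unfolding sp by blast+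
    then show ?thesis using ind unfolding indep_sets2_eq by (meson subset_iff)
  qed
  then have "indep_sets (\<lambda>i. {case_bool f g i -` E \<inter> space M |E. E \<in> sets borel}) UNIV"
    unfolding indep_set_def by (rule indep_sets_mono_sets) (simp split: bool.split)
  then have "indep_vars (\<lambda>_. borel) (case_bool f g) UNIV"
    using fm unfolding indep_vars_def2 by (simp split: bool.split)
  then have "(\<integral>\<^sup>+\<omega>. (\<Prod>i\<in>UNIV. case_bool f g i \<omega>) \<partial>M) = (\<Prod>i\<in>UNIV. \<integral>\<^sup>+\<omega>. case_bool f g i \<omega> \<partial>M)"
    by (rule indep_vars_nn_integral[OF finite_class.finite_UNIV]) simp_all
  then show ?thesis by (simp add: UNIV_bool mult.commute)
qed

section \<open>Exponential moments of Gaussian linear forms\<close>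

lemma nn_integral_normal_density:
  assumes "0 < \<sigma>"
  shows "(\<integral>\<^sup>+x. ennreal (normal_density \<mu> \<sigma> x) \<partial>lborel) = 1"
  using assms by (subst nn_integral_eq_integral) auto

text \<open>Completing the square: an exponential tilt of a centred Gaussian density only shifts its
  mean, so that what remains to be integrated is a probability density.\<close>

lemma exp_mult_normal_density:
  assumes "0 < \<sigma>"
  shows "normal_density 0 \<sigma> x * exp (u * x) = exp (u\<^sup>2 * \<sigma>\<^sup>2 / 2) * normal_density (u * \<sigma>\<^sup>2) \<sigma> x"
proof -
  have "- x\<^sup>2 / (2 * \<sigma>\<^sup>2) + u * x = u\<^sup>2 * \<sigma>\<^sup>2 / 2 - (x - u * \<sigma>\<^sup>2)\<^sup>2 / (2 * \<sigma>\<^sup>2)"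
  proof -
    have "(x - u * \<sigma>\<^sup>2)\<^sup>2 / (2 * \<sigma>\<^sup>2) = (x\<^sup>2 + (2 * \<sigma>\<^sup>2) * (u\<^sup>2 * \<sigma>\<^sup>2 / 2 - u * x)) / (2 * \<sigma>\<^sup>2)"
      by (simp add: power2_eq_square algebra_simps)
    also have "\<dots> = x\<^sup>2 / (2 * \<sigma>\<^sup>2) + (u\<^sup>2 * \<sigma>\<^sup>2 / 2 - u * x)"
      using assms by (simp only: add_divide_distrib) simp
    finally show ?thesis by linarith
  qed
  then have "exp (- x\<^sup>2 / (2 * \<sigma>\<^sup>2)) * exp (u * x) = exp (u\<^sup>2 * \<sigma>\<^sup>2 / 2) * exp (- (x - u * \<sigma>\<^sup>2)\<^sup>2 / (2 * \<sigma>\<^sup>2))"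
    unfolding exp_add[symmetric] by simp
  then show ?thesis unfolding normal_density_def diff_zero
    by (simp only: mult.assoc mult.left_commute[of "exp (u\<^sup>2 * \<sigma>\<^sup>2 / 2)"])
qed

lemma nn_integral_exp_normal_density:
  assumes "0 < \<sigma>"
  shows "(\<integral>\<^sup>+x. ennreal (normal_density 0 \<sigma> x) * ennreal (exp (u * x)) \<partial>lborel) = ennreal (exp (u\<^sup>2 * \<sigma>\<^sup>2 / 2))"
proof -
  have "(\<integral>\<^sup>+x. ennreal (normal_density 0 \<sigma> x) * ennreal (exp (u * x)) \<partial>lborel)
      = (\<integral>\<^sup>+x. ennreal (exp (u\<^sup>2 * \<sigma>\<^sup>2 / 2)) * ennreal (normal_density (u * \<sigma>\<^sup>2) \<sigma> x) \<partial>lborel)"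
    by (intro nn_integral_cong) (simp only: ennreal_mult'[symmetric] normal_density_nonneg exp_ge_zero
      exp_mult_normal_density[OF assms])
  then show ?thesis by (simp add: nn_integral_cmult nn_integral_normal_density[OF assms])
qed

lemma nn_integral_exp_distributed_normal:
  assumes "distributed M lborel X (normal_density 0 \<sigma>)" "0 < \<sigma>"
  shows "(\<integral>\<^sup>+\<omega>. ennreal (exp (u * X \<omega>)) \<partial>M) = ennreal (exp (u\<^sup>2 * \<sigma>\<^sup>2 / 2))"
  using distributed_nn_integral[OF assms(1), of "\<lambda>x. ennreal (exp (u * x))"]
    nn_integral_exp_normal_density[OF assms(2), of u] by simp

lemma nn_integral_exp_brownian_increments:
  assumes bm: "standard_brownian_motion M w" and N: "N \<ge> 1"
  shows "(\<integral>\<^sup>+\<omega>. ennreal (exp (\<Sum>k<K. h k * (w (real (Suc k) / real N) \<omega> - w (real k / real N) \<omega>))) \<partial>M)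
    = ennreal (exp (1 / 2 * (1 / real N * (\<Sum>k<K. (h k)\<^sup>2))))"
proof -
  interpret prob_space M using bm unfolding standard_brownian_motion_def by simp
  define t where "t k = real k / real N" for k
  have t: "0 \<le> t k" "t k < t (Suc k)" "t (Suc k) - t k = 1 / real N" for k
    using N by (auto simp: t_def divide_strict_right_mono diff_divide_distrib[symmetric])
  define d where "d k \<omega> = w (t (Suc k)) \<omega> - w (t k) \<omega>" for k \<omega>
  have ind: "indep_vars (\<lambda>_. borel) d {..<K}"
    using bm t unfolding standard_brownian_motion_def d_def by auto
  have ind': "indep_vars (\<lambda>_. borel) (\<lambda>k \<omega>. ennreal (exp (h k * d k \<omega>))) {..<K}"
    by (rule indep_vars_compose2[OF ind]) measurable
  have D: "(\<integral>\<^sup>+\<omega>. ennreal (exp (h k * d k \<omega>)) \<partial>M) = ennreal (exp ((h k)\<^sup>2 * (1 / real N) / 2))" for k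
  proof -
    have "distributed M lborel (d k) (normal_density 0 (sqrt (1 / real N)))"
      using bm t(1)[of k] t(2)[of k] t(3)[of k] unfolding standard_brownian_motion_def d_def by metis
    from nn_integral_exp_distributed_normal[OF this, of "h k"] show ?thesis using N by simp
  qed
  have "(\<integral>\<^sup>+\<omega>. ennreal (exp (\<Sum>k<K. h k * d k \<omega>)) \<partial>M) = (\<integral>\<^sup>+\<omega>. (\<Prod>k<K. ennreal (exp (h k * d k \<omega>))) \<partial>M)"
    by (simp add: exp_sum prod_ennreal)
  also have "\<dots> = (\<Prod>k<K. \<integral>\<^sup>+\<omega>. ennreal (exp (h k * d k \<omega>)) \<partial>M)"
    by (rule indep_vars_nn_integral[OF _ ind']) auto
  also have "\<dots> = ennreal (exp (\<Sum>k<K. (h k)\<^sup>2 * (1 / real N) / 2))"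
    by (simp add: D exp_sum prod_ennreal)
  also have "(\<Sum>k<K. (h k)\<^sup>2 * (1 / real N) / 2) = 1 / 2 * (1 / real N * (\<Sum>k<K. (h k)\<^sup>2))"
    by (simp add: sum_distrib_left field_simps)
  finally show ?thesis by (simp add: d_def t_def)
qed

text \<open>The factor \<theta> in the coefficient makes both sides 1 when \<theta> = 0, where
  \<xi>_0 has no density; otherwise the exponent is half of (\<theta> B)^2 / (2 |\<theta>|).\<close>

lemma nn_integral_exp_ou_initial:
  assumes ou: "ornstein_uhlenbeck M \<theta> w \<xi>" and "\<theta> \<le> 0" "prob_space M"
  shows "(\<integral>\<^sup>+\<omega>. ennreal (exp (- \<theta> * B * \<xi> 0 \<omega>)) \<partial>M) = ennreal (exp (- \<theta> * B\<^sup>2 / 4))"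
proof (cases "\<theta> = 0")
  case True
  interpret prob_space M by fact
  show ?thesis using True by (simp add: emeasure_space_1)
next
  case False
  then have D: "distributed M lborel (\<xi> 0) (normal_density 0 (sqrt (1 / (2 * \<bar>\<theta>\<bar>))))"
    using ou unfolding ornstein_uhlenbeck_def by simp
  have "(\<theta> * B)\<^sup>2 * (1 / (2 * \<bar>\<theta>\<bar>)) / 2 = - \<theta> * B\<^sup>2 / 4"
    using False assms(2) by (simp add: field_simps power2_eq_square)
  then show ?thesis
    using nn_integral_exp_distributed_normal[OF D, of "- \<theta> * B"] False by simp
qed

text \<open>The bracket is the variance of the linear form: - \<theta> B^2 / 2 comes from the
  initial value and h_k^2 / N from each increment.\<close>

lemma nn_integral_exp_initial_increments:
  assumes bm: "standard_brownian_motion M w" and ou: "ornstein_uhlenbeck M \<theta> w \<xi>"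
    and th: "\<theta> \<le> 0" and N: "N \<ge> 1"
  shows "(\<integral>\<^sup>+\<omega>. ennreal (exp (- \<theta> * B * \<xi> 0 \<omega>
       + (\<Sum>k<K. h k * (w (real (Suc k) / real N) \<omega> - w (real k / real N) \<omega>)))) \<partial>M)
    = ennreal (exp (1 / 2 * (- \<theta> / 2 * B\<^sup>2 + 1 / real N * (\<Sum>k<K. (h k)\<^sup>2))))"
proof -
  interpret prob_space M using bm unfolding standard_brownian_motion_def by simp
  let ?A = "vimage_algebra (space M) (\<xi> 0) borel"
  let ?P = "Pi\<^sub>M {0..} (\<lambda>_. borel) :: (real \<Rightarrow> real) measure"
  let ?V = "\<lambda>\<omega>. \<lambda>t\<in>{0..}. w t \<omega>"
  let ?B = "vimage_algebra (space M) ?V ?P"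
  have ind: "indep_set (sets ?A) (sets ?B)"
    using ou unfolding ornstein_uhlenbeck_def by simp
  have x: "\<xi> 0 \<in> borel_measurable ?A" by (rule measurable_vimage_algebra1) simp
  have V: "?V \<in> measurable ?B ?P" by (rule measurable_vimage_algebra1) (auto simp: space_PiM)
  have w: "w t \<in> borel_measurable ?B" if "0 \<le> t" for t
    using measurable_compose[OF V measurable_component_singleton[of t]] that by simp
  have "(\<integral>\<^sup>+\<omega>. ennreal (exp (- \<theta> * B * \<xi> 0 \<omega>
       + (\<Sum>k<K. h k * (w (real (Suc k) / real N) \<omega> - w (real k / real N) \<omega>)))) \<partial>M)
    = (\<integral>\<^sup>+\<omega>. ennreal (exp (- \<theta> * B * \<xi> 0 \<omega>)) *
       ennreal (exp (\<Sum>k<K. h k * (w (real (Suc k) / real N) \<omega> - w (real k / real N) \<omega>))) \<partial>M)"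
    by (simp only: exp_add ennreal_mult' exp_ge_zero)
  also have "\<dots> = ennreal (exp (- \<theta> * B\<^sup>2 / 4)) * ennreal (exp (1 / 2 * (1 / real N * (\<Sum>k<K. (h k)\<^sup>2))))"
    unfolding nn_integral_exp_ou_initial[OF ou th prob_space_axioms, symmetric]
      nn_integral_exp_brownian_increments[OF bm N, symmetric]
  proof (rule nn_integral_mult_indep_set[OF ind])
    show "(\<lambda>\<omega>. ennreal (exp (- \<theta> * B * \<xi> 0 \<omega>))) \<in> borel_measurable ?A" using x by measurable
    show "(\<lambda>\<omega>. ennreal (exp (\<Sum>k<K. h k * (w (real (Suc k) / real N) \<omega> - w (real k / real N) \<omega>))))
      \<in> borel_measurable ?B"
      by (rule measurable_compose[OF measurable_compose[OF _ borel_measurable_exp] measurable_ennreal],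
          intro borel_measurable_sum borel_measurable_times borel_measurable_diff measurable_const w) auto
  qed auto
  also have "\<dots> = ennreal (exp (1 / 2 * (- \<theta> / 2 * B\<^sup>2 + 1 / real N * (\<Sum>k<K. (h k)\<^sup>2))))"
    by (simp add: ennreal_mult[symmetric] exp_add[symmetric] distrib_left)
  finally show ?thesis .
qed

section \<open>From the grid to continuous time\<close>

text \<open>Only an upper bound on the limit is wanted, so almost sure convergence is enough and no
  uniform integrability of the exponentials has to be established.\<close>

lemma nn_integral_Fatou_exp:
  assumes m: "\<And>N. Y N \<in> borel_measurable M" and Z: "Z \<in> borel_measurable M"
    and lim: "AE \<omega> in M. (\<lambda>N. Y N \<omega>) \<longlonglongrightarrow> Z \<omega>"
    and le: "eventually (\<lambda>N. (\<integral>\<^sup>+\<omega>. ennreal (exp (Y N \<omega>)) \<partial>M) \<le> ennreal (exp (c N))) sequentially"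
    and c: "c \<longlonglongrightarrow> C"
  shows "(\<integral>\<^sup>+\<omega>. ennreal (exp (Z \<omega>)) \<partial>M) \<le> ennreal (exp C)"
proof -
  have "(\<integral>\<^sup>+\<omega>. ennreal (exp (Z \<omega>)) \<partial>M) = (\<integral>\<^sup>+\<omega>. liminf (\<lambda>N. ennreal (exp (Y N \<omega>))) \<partial>M)"
  proof (rule nn_integral_cong_AE, use lim in eventually_elim)
    case (elim \<omega>)
    have "(\<lambda>N. ennreal (exp (Y N \<omega>))) \<longlonglongrightarrow> ennreal (exp (Z \<omega>))"
      by (intro tendsto_ennrealI tendsto_exp elim)
    from lim_imp_Liminf[OF _ this] show ?case by simp
  qed
  also have "\<dots> \<le> liminf (\<lambda>N. \<integral>\<^sup>+\<omega>. ennreal (exp (Y N \<omega>)) \<partial>M)"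
    by (rule nn_integral_liminf) (use m in measurable)
  also have "\<dots> \<le> liminf (\<lambda>N. ennreal (exp (c N)))"
    by (rule Liminf_mono[OF le])
  also have "\<dots> = ennreal (exp C)"
    by (intro lim_imp_Liminf tendsto_ennrealI tendsto_exp c) simp
  finally show ?thesis .
qed

text \<open>By the integral equation the remainder is \<theta> times the integral of x s - x a over
  [a, b], and \<open>e\<close> bounds the oscillation of the path there.\<close>

lemma ou_increment_remainder_le:
  fixes x w :: "real \<Rightarrow> real"
  assumes cont: "continuous_on {0..} x"
    and x: "\<And>t. 0 \<le> t \<Longrightarrow> x t = x 0 + \<theta> * (LINT s:{0..t}|lborel. x s) + w t"
    and ab: "0 \<le> a" "a \<le> b" and e: "\<And>s. s \<in> {a..b} \<Longrightarrow> \<bar>x s - x a\<bar> \<le> e"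
  shows "\<bar>x b - x a - \<theta> * (b - a) * x a - (w b - w a)\<bar> \<le> \<bar>\<theta>\<bar> * (e * (b - a))"
proof -
  have I: "(LINT s:{0..t}|lborel. x s) = integral {0..t} x" if "0 \<le> t" for t
    using that by (intro set_borel_integral_eq_integral borel_integrable_atLeastAtMost'
      continuous_on_subset[OF cont]) auto
  have int: "x integrable_on {u..v}" if "0 \<le> u" for u v
    using that by (intro integrable_continuous_real continuous_on_subset[OF cont]) auto
  have c: "integral {0..a} x + integral {a..b} x = integral {0..b} x"
    using ab by (intro Henstock_Kurzweil_Integration.integral_combine int) auto
  have "\<theta> * integral {0..b} x = \<theta> * integral {0..a} x + \<theta> * integral {a..b} x"
    by (simp only: distrib_left[symmetric] c)
  moreover have "x b = x 0 + \<theta> * integral {0..b} x + w b" "x a = x 0 + \<theta> * integral {0..a} x + w a"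
    using x[of a] x[of b] I[of a] I[of b] ab by simp_all
  ultimately have "x b - x a - \<theta> * (b - a) * x a - (w b - w a) = \<theta> * integral {a..b} x - \<theta> * (b - a) * x a"
    by linarith
  also have "\<dots> = \<theta> * (integral {a..b} x - (b - a) * x a)"
    by (simp add: algebra_simps)
  also have "integral {a..b} x - (b - a) * x a = integral {a..b} (\<lambda>s. x s - x a)"
    using ab(2) by (subst Henstock_Kurzweil_Integration.integral_diff[OF int[OF ab(1)]]) auto
  finally have r: "x b - x a - \<theta> * (b - a) * x a - (w b - w a) = \<theta> * integral {a..b} (\<lambda>s. x s - x a)" .
  have "norm (integral {a..b} (\<lambda>s. x s - x a)) \<le> e * (b - a)"
  proof (rule integral_bound)
    show "continuous_on {a..b} (\<lambda>s. x s - x a)"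
      using ab by (intro continuous_on_diff continuous_on_const continuous_on_subset[OF cont]) auto
  qed (use ab e in auto)
  then show ?thesis unfolding r abs_mult by (intro mult_left_mono) auto
qed

text \<open>There are n N cells, each contributing at most H |\<theta>| / N times the oscillation of
  the path over one cell. The total is n H |\<theta>| times an oscillation that vanishes by uniform
  continuity on [0, n].\<close>

lemma ou_drift_remainder_tendsto:
  fixes x w :: "real \<Rightarrow> real"
  assumes cont: "continuous_on {0..} x"
    and x: "\<And>t. 0 \<le> t \<Longrightarrow> x t = x 0 + \<theta> * (LINT s:{0..t}|lborel. x s) + w t"
    and h: "\<And>N k. N \<ge> 1 \<Longrightarrow> k < n * N \<Longrightarrow> \<bar>h N k\<bar> \<le> H" and H: "0 \<le> H"
  shows "(\<lambda>N. \<Sum>k<n * N. h N k * (x (real (Suc k) / real N) - x (real k / real N)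
      - \<theta> * (1 / real N) * x (real k / real N)
      - (w (real (Suc k) / real N) - w (real k / real N)))) \<longlonglongrightarrow> 0"
    (is "(\<lambda>N. \<Sum>k<n * N. h N k * ?r N k) \<longlonglongrightarrow> 0")
proof (rule LIMSEQ_I)
  fix e :: real assume e: "e > 0"
  \<comment> \<open>The summand 1 keeps \<open>c\<close> positive when H or \<theta> is 0, so that
    it may be divided by.\<close>
  define c where "c = real n * H * \<bar>\<theta>\<bar> + 1"
  have c: "c > 0" using H by (simp add: c_def add_nonneg_pos)
  define e' where "e' = e / (2 * c)"
  have e': "e' > 0" using e c by (simp add: e'_def)
  have "uniformly_continuous_on {0..real n} x"
    by (rule compact_uniformly_continuous) (auto intro: continuous_on_subset[OF cont])
  then obtain d where d: "d > 0" and
    ud: "\<And>s t. s \<in> {0..real n} \<Longrightarrow> t \<in> {0..real n} \<Longrightarrow> dist t s < d \<Longrightarrow> dist (x t) (x s) < e'"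
    unfolding uniformly_continuous_on_def using e' by metis
  obtain N0 :: nat where N0: "1 / d < real N0" using reals_Archimedean2 by blast
  show "\<exists>no. \<forall>N\<ge>no. norm ((\<Sum>k<n * N. h N k * ?r N k) - 0) < e"
  proof (intro exI[of _ "N0 + 1"] allI impI)
    fix N assume N: "N0 + 1 \<le> N"
    have N1: "N \<ge> 1" using N by simp
    have "1 / d < real N" using N N0 by linarith
    then have Nd: "1 / real N < d" using d N by (simp add: field_simps)
    have r: "\<bar>?r N k\<bar> \<le> \<bar>\<theta>\<bar> * (e' * (1 / real N))" if k: "k < n * N" for k
    proof -
      define a where "a = real k / real N"
      define b where "b = real (Suc k) / real N"
      have ab: "0 \<le> a" "a \<le> b" and ba: "b - a = 1 / real N"
        using N by (auto simp: a_def b_def divide_right_mono diff_divide_distrib[symmetric])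
      have "real (Suc k) \<le> real n * real N" using k by (metis Suc_leI of_nat_le_iff of_nat_mult)
      then have b: "b \<le> real n" using N unfolding b_def by (simp add: field_simps)
      have "\<bar>x b - x a - \<theta> * (b - a) * x a - (w b - w a)\<bar> \<le> \<bar>\<theta>\<bar> * (e' * (b - a))"
      proof (rule ou_increment_remainder_le[OF cont x ab])
        fix t assume t: "t \<in> {a..b}"
        then have "dist t a < d" using Nd ba by (auto simp: dist_real_def)
        moreover have "t \<in> {0..real n}" "a \<in> {0..real n}" using t ab b by auto
        ultimately have "dist (x t) (x a) < e'" using ud by blast
        then show "\<bar>x t - x a\<bar> \<le> e'" by (simp add: dist_real_def)
      qed
      then show ?thesis unfolding ba unfolding a_def b_def .
    qed
    have "\<bar>\<Sum>k<n * N. h N k * ?r N k\<bar> \<le> (\<Sum>k<n * N. \<bar>h N k * ?r N k\<bar>)" by (rule sum_abs)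
    also have "\<dots> \<le> (\<Sum>k<n * N. H * (\<bar>\<theta>\<bar> * (e' * (1 / real N))))"
    proof (rule sum_mono)
      fix k assume "k \<in> {..<n * N}"
      then have k: "k < n * N" by simp
      show "\<bar>h N k * ?r N k\<bar> \<le> H * (\<bar>\<theta>\<bar> * (e' * (1 / real N)))"
        unfolding abs_mult[of "h N k"] using h[OF N1 k] r[OF k] H by (rule mult_mono) simp
    qed
    also have "\<dots> = (real n * H * \<bar>\<theta>\<bar>) * e'" using N by simp
    also have "\<dots> \<le> c * e'" using e' by (intro mult_right_mono) (auto simp: c_def)
    also have "\<dots> = e / 2" using c unfolding e'_def by simp
    also have "\<dots> < e" using e by simp
    finally show "norm ((\<Sum>k<n * N. h N k * ?r N k) - 0) < e" by simp
  qed
qed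

lemma step_integral_measurable:
  assumes y: "\<And>t. t \<in> {0..T} \<Longrightarrow> y t \<in> borel_measurable M" and "steps_within T X"
  shows "step_integral X y \<in> borel_measurable M"
  using assms(2)
proof (induction X)
  case (Cons p X)
  obtain c a b where p: "p = (c, a, b)" by (metis surj_pair)
  have "y a \<in> borel_measurable M" "y b \<in> borel_measurable M" using Cons.prems p by (auto intro: y)
  then have "(\<lambda>\<omega>. c * (y b \<omega> - y a \<omega>) + step_integral X y \<omega>) \<in> borel_measurable M"
    using Cons by (intro borel_measurable_add borel_measurable_times borel_measurable_diff) auto
  then show ?case unfolding p step_integral_Cons[abs_def] .
qed (simp add: step_integral_def[abs_def])

text \<open>\<open>Y\<close> is the part of the grid sum whose exponential moment can be computed
  exactly. It agrees with the grid sum only up to a pathwise vanishing remainder, so the bound is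
  obtained in the limit and not at finite N.\<close>

lemma nn_integral_exp_step_integral_ou:
  assumes bm: "standard_brownian_motion M w" and ou: "ornstein_uhlenbeck M \<theta> w \<xi>"
    and th: "\<theta> \<le> 0" and X: "steps_within (real n) X"
  shows "(\<integral>\<^sup>+\<omega>. ennreal (exp (step_integral X \<xi> \<omega>)) \<partial>M)
    \<le> ennreal (exp (1 / 2 * (LINT t:{0..real n}|lebesgue. (step_fun X t)\<^sup>2)))"
proof -
  interpret prob_space M using bm unfolding standard_brownian_motion_def by simp
  have w: "random_variable borel (w t)" if "0 \<le> t" for t
    using bm that unfolding standard_brownian_motion_def by simp
  have \<xi>: "random_variable borel (\<xi> t)" if "0 \<le> t" for t
    using ou that unfolding ornstein_uhlenbeck_def by simp
  obtain G where G: "\<And>t. \<bar>step_fun X t\<bar> \<le> G" using abs_step_fun_le by blast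
  define \<kappa> where "\<kappa> = - \<theta>"
  have \<kappa>: "0 \<le> \<kappa>" using th by (simp add: \<kappa>_def)
  \<comment> \<open>From this N on the mesh is fine enough for the condition \<kappa> D < 1 of the
    summation by parts, with D = 1 / N.\<close>
  obtain N0 :: nat where N0: "1 + \<kappa> < real N0" using reals_Archimedean2 by blast
  then have N0': "N0 \<ge> 1" using \<kappa> by (cases N0) auto
  define g where "g N k = step_fun X (real (Suc k) / real N)" for N k
  \<comment> \<open>Bundles the result of the summation by parts at mesh 1 / N, so that B and h can
    be chosen for all N at once. The n N steps cover the horizon n, hence the bound on h does not
    depend on N.\<close>
  define P where "P N B h \<longleftrightarrow> (\<forall>k<n*N. \<bar>h k\<bar> \<le> G * (1 + \<kappa> * real n)) \<and>
     \<kappa> * B\<^sup>2 + 1 / real N * (\<Sum>k<n*N. (h k)\<^sup>2) \<le> (1 / real N) / (1 - \<kappa> * (1 / real N)) * (\<Sum>k<n*N. (g N k)\<^sup>2) \<and>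
    (\<forall>x e. (\<forall>k<n*N. x (Suc k) - x k = e k - \<kappa> * (1 / real N) * x k) \<longrightarrow>
      (\<Sum>k<n*N. g N k * (x (Suc k) - x k)) = \<kappa> * B * x 0 + (\<Sum>k<n*N. h k * e k))" for N B h
  have ex: "\<exists>B h. P N B h" if "N \<ge> N0" for N
  proof -
    have N: "0 < real N" "\<kappa> * (1 / real N) < 1" using that N0 N0' by (auto simp: field_simps)
    have eq: "\<kappa> * (real (n * N) * (1 / real N)) = \<kappa> * real n" using N by simp
    have "0 < 1 / real N" "\<And>k. \<bar>g N k\<bar> \<le> G" using N G by (auto simp: g_def)
    from ar_summation_by_parts[where g = "g N", OF \<kappa> this(1) N(2) this(2), of "n * N", unfolded eq]
    show ?thesis unfolding P_def by (elim exE conjE) (intro exI conjI; assumption)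
  qed
  then obtain B h where Bh: "\<And>N. N \<ge> N0 \<Longrightarrow> P N (B N) (h N)" by metis
  \<comment> \<open>B and h are specified only from \<open>N0\<close> on, hence the shift of the
    index.\<close>
  define Y where "Y N \<omega> = - \<theta> * B (N + N0) * \<xi> 0 \<omega> + (\<Sum>k<n*(N + N0). h (N + N0) k *
     (w (real (Suc k) / real (N + N0)) \<omega> - w (real k / real (N + N0)) \<omega>))" for N \<omega>
  define c where "c N = 1 / 2 * ((1 / real N) / (1 - \<kappa> * (1 / real N)) * (\<Sum>k<n*N. (g N k)\<^sup>2))" for N
  show ?thesis
  proof (rule nn_integral_Fatou_exp)
    show "Y N \<in> borel_measurable M" for N unfolding Y_def
      by (intro borel_measurable_add borel_measurable_sum borel_measurable_times borel_measurable_diff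
         measurable_const w \<xi>) auto
    show "step_integral X \<xi> \<in> borel_measurable M"
      using \<xi> X by (rule step_integral_measurable) simp
    show "eventually (\<lambda>N. (\<integral>\<^sup>+\<omega>. ennreal (exp (Y N \<omega>)) \<partial>M) \<le> ennreal (exp (c (N + N0)))) sequentially"
    proof (intro always_eventually allI)
      fix N
      have "(\<integral>\<^sup>+\<omega>. ennreal (exp (Y N \<omega>)) \<partial>M)
         = ennreal (exp (1 / 2 * (- \<theta> / 2 * (B (N + N0))\<^sup>2 + 1 / real (N + N0) * (\<Sum>k<n*(N + N0). (h (N + N0) k)\<^sup>2))))"
        unfolding Y_def using N0' by (intro nn_integral_exp_initial_increments[OF bm ou th]) auto
      also have "\<dots> \<le> ennreal (exp (c (N + N0)))"
      proof (intro ennreal_leI, subst exp_le_cancel_iff, unfold c_def, intro mult_left_mono)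
        \<comment> \<open>The stationary initial value contributes half of the term \<kappa> B^2 for
          which the energy estimate makes room.\<close>
        have "- \<theta> / 2 * (B (N + N0))\<^sup>2 \<le> \<kappa> * (B (N + N0))\<^sup>2" using \<kappa>
          unfolding \<kappa>_def by (intro mult_right_mono) auto
        then show "- \<theta> / 2 * (B (N + N0))\<^sup>2 + 1 / real (N + N0) * (\<Sum>k<n*(N + N0). (h (N + N0) k)\<^sup>2)
          \<le> (1 / real (N + N0)) / (1 - \<kappa> * (1 / real (N + N0))) * (\<Sum>k<n*(N + N0). (g (N + N0) k)\<^sup>2)"
          using Bh[of "N + N0"] unfolding P_def by linarith
      qed simp
      finally show "(\<integral>\<^sup>+\<omega>. ennreal (exp (Y N \<omega>)) \<partial>M) \<le> ennreal (exp (c (N + N0)))" .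
    qed
    show "(\<lambda>N. c (N + N0)) \<longlonglongrightarrow> 1 / 2 * (LINT t:{0..real n}|lebesgue. (step_fun X t)\<^sup>2)"
    proof (rule LIMSEQ_ignore_initial_segment[where f = c and k = N0])
      \<comment> \<open>This factor is the excess of the discrete energy estimate over the sharp
        constant 1.\<close>
      have k: "(\<lambda>N. 1 / (1 - \<kappa> * (1 / real N))) \<longlonglongrightarrow> 1" by real_asymp
      define q where "q N = 1 / real N * (\<Sum>k<n * N. (g N k)\<^sup>2)" for N
      have "q \<longlonglongrightarrow> (LINT t:{0..real n}|lebesgue. (step_fun X t)\<^sup>2)"
        using grid_sum_tendsto_integral_step_fun_square[OF X] unfolding q_def[abs_def] g_def .
      from tendsto_mult_left[OF tendsto_mult[OF k this], of "1 / 2"]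
      have "(\<lambda>N. 1 / 2 * (1 / (1 - \<kappa> * (1 / real N)) * q N)) \<longlonglongrightarrow> 1 / 2 * (LINT t:{0..real n}|lebesgue. (step_fun X t)\<^sup>2)"
        by (simp only: mult_1_left)
      moreover have "c N = 1 / 2 * (1 / (1 - \<kappa> * (1 / real N)) * q N)" for N
        by (simp add: c_def q_def)
      ultimately show "c \<longlonglongrightarrow> 1 / 2 * (LINT t:{0..real n}|lebesgue. (step_fun X t)\<^sup>2)"
        by presburger
    qed
    have "AE \<omega> in M. continuous_on {0..} (\<lambda>t. \<xi> t \<omega>) \<and>
        (\<forall>t\<ge>0. \<xi> t \<omega> = \<xi> 0 \<omega> + \<theta> * (LINT s:{0..t}|lborel. \<xi> s \<omega>) + w t \<omega>)"
      using ou unfolding ornstein_uhlenbeck_def by simp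
    then show "AE \<omega> in M. (\<lambda>N. Y N \<omega>) \<longlonglongrightarrow> step_integral X \<xi> \<omega>"
    proof eventually_elim
      case (elim \<omega>)
      define x where "x N k = \<xi> (real k / real N) \<omega>" for N k
      define u where "u N k = w (real (Suc k) / real N) \<omega> - w (real k / real N) \<omega>" for N k
      define r where "r N k = x N (Suc k) - x N k - \<theta> * (1 / real N) * x N k - u N k" for N k
      \<comment> \<open>The remainder lemma asks for a bound on the weights at every N \<ge> 1;
        below \<open>N0\<close> nothing is known of h, so it is replaced by 0.\<close>
      define h' where "h' N k = (if N \<ge> N0 then h N k else 0)" for N k
      have cont: "continuous_on {0..} (\<lambda>t. \<xi> t \<omega>)" using elim by blast
      have ode: "\<xi> t \<omega> = \<xi> 0 \<omega> + \<theta> * (LINT s:{0..t}|lborel. \<xi> s \<omega>) + w t \<omega>" if "0 \<le> t" for t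
        using elim that by blast
      have H: "0 \<le> G * (1 + \<kappa> * real n)" using \<kappa> G[of 0] by (intro mult_nonneg_nonneg) auto
      have h': "\<bar>h' N k\<bar> \<le> G * (1 + \<kappa> * real n)" if "N \<ge> 1" "k < n * N" for N k
        using Bh[of N] H that unfolding P_def h'_def by simp
      have r: "(\<lambda>N. \<Sum>k<n * N. h' N k * r N k) \<longlonglongrightarrow> 0"
        using ou_drift_remainder_tendsto[where x = "\<lambda>t. \<xi> t \<omega>" and w = "\<lambda>t. w t \<omega>", OF cont ode h' H]
        unfolding r_def x_def u_def .
      have s: "(\<lambda>N. \<Sum>k<n * N. g N k * (x N (Suc k) - x N k)) \<longlonglongrightarrow> step_integral X \<xi> \<omega>"
        using grid_sum_tendsto_step_integral[where \<xi> = \<xi> and \<omega> = \<omega>, OF X cont] unfolding g_def x_def .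
      \<comment> \<open>The path follows the recursion exactly once the remainder is counted as
        driving noise, e = u + r. Its share of the sum is then moved to the left.\<close>
      have eq: "(\<Sum>k<n * N. g N k * (x N (Suc k) - x N k)) - (\<Sum>k<n * N. h' N k * r N k)
         = - \<theta> * B N * \<xi> 0 \<omega> + (\<Sum>k<n * N. h N k * u N k)" if N: "N \<ge> N0" for N
      proof -
        have "(\<Sum>k<n * N. g N k * (x N (Suc k) - x N k)) = \<kappa> * B N * x N 0 + (\<Sum>k<n*N. h N k * (u N k + r N k))"
        proof -
          have "\<forall>x e. (\<forall>k<n * N. x (Suc k) - x k = e k - \<kappa> * (1 / real N) * x k) \<longrightarrow>
            (\<Sum>k<n * N. g N k * (x (Suc k) - x k)) = \<kappa> * B N * x 0 + (\<Sum>k<n * N. h N k * e k)"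
            using Bh[OF N] unfolding P_def by blast
          from this[rule_format, of "x N" "\<lambda>k. u N k + r N k"]
          show ?thesis by (simp add: r_def \<kappa>_def)
        qed
        moreover have "x N 0 = \<xi> 0 \<omega>" by (simp add: x_def)
        ultimately show ?thesis using N by (simp add: \<kappa>_def h'_def distrib_left sum.distrib)
      qed
      have "(\<lambda>N. (\<Sum>k<n * (N + N0). g (N + N0) k * (x (N + N0) (Suc k) - x (N + N0) k))
          - (\<Sum>k<n * (N + N0). h' (N + N0) k * r (N + N0) k)) \<longlonglongrightarrow> step_integral X \<xi> \<omega> - 0"
        by (intro tendsto_diff LIMSEQ_ignore_initial_segment[OF s] LIMSEQ_ignore_initial_segment[OF r])
      then show ?case by (simp only: eq le_add2) (simp add: Y_def u_def)
    qed
  qed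
qed

section \<open>Stochastic integrals\<close>

lemma step_integral_append: "step_integral (X @ Y) y \<omega> = step_integral X y \<omega> + step_integral Y y \<omega>"
  by (simp add: step_integral_def)

lemma step_fun_scale: "step_fun (map (\<lambda>(d, a, b). (c * d, a, b)) X) t = c * step_fun X t"
  by (induction X) (auto simp: step_fun_Cons algebra_simps)

lemma step_integral_scale: "step_integral (map (\<lambda>(d, a, b). (c * d, a, b)) X) y \<omega> = c * step_integral X y \<omega>"
  by (induction X) (auto simp: step_integral_Cons algebra_simps)

lemma tendsto_nn_integral_square_add:
  fixes A B :: "nat \<Rightarrow> 'a \<Rightarrow> real"
  assumes [measurable]: "\<And>k. A k \<in> borel_measurable M" "\<And>k. B k \<in> borel_measurable M"
    and A: "(\<lambda>k. \<integral>\<^sup>+x. ennreal ((A k x)\<^sup>2) \<partial>M) \<longlonglongrightarrow> 0"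
    and B: "(\<lambda>k. \<integral>\<^sup>+x. ennreal ((B k x)\<^sup>2) \<partial>M) \<longlonglongrightarrow> 0"
  shows "(\<lambda>k. \<integral>\<^sup>+x. ennreal ((A k x + B k x)\<^sup>2) \<partial>M) \<longlonglongrightarrow> 0"
proof (rule tendsto_sandwich[OF _ _ tendsto_const])
  show "\<forall>\<^sub>F k in sequentially. (\<integral>\<^sup>+x. ennreal ((A k x + B k x)\<^sup>2) \<partial>M)
     \<le> 2 * (\<integral>\<^sup>+x. ennreal ((A k x)\<^sup>2) \<partial>M) + 2 * (\<integral>\<^sup>+x. ennreal ((B k x)\<^sup>2) \<partial>M)"
  proof (intro always_eventually allI)
    fix k
    have "(\<integral>\<^sup>+x. ennreal ((A k x + B k x)\<^sup>2) \<partial>M) \<le> (\<integral>\<^sup>+x. 2 * ennreal ((A k x)\<^sup>2) + 2 * ennreal ((B k x)\<^sup>2) \<partial>M)"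
    proof (rule nn_integral_mono)
      fix x
      have "(A k x + B k x)\<^sup>2 \<le> 2 * (A k x)\<^sup>2 + 2 * (B k x)\<^sup>2"
        using sum_squares_bound[of "A k x" "B k x"] by (simp add: power2_sum)
      then have "ennreal ((A k x + B k x)\<^sup>2) \<le> ennreal (2 * (A k x)\<^sup>2 + 2 * (B k x)\<^sup>2)"
        by (rule ennreal_leI)
      also have "\<dots> = 2 * ennreal ((A k x)\<^sup>2) + 2 * ennreal ((B k x)\<^sup>2)"
        by (simp add: ennreal_mult')
      finally show "ennreal ((A k x + B k x)\<^sup>2) \<le> 2 * ennreal ((A k x)\<^sup>2) + 2 * ennreal ((B k x)\<^sup>2)" .
    qed
    also have "\<dots> = 2 * (\<integral>\<^sup>+x. ennreal ((A k x)\<^sup>2) \<partial>M) + 2 * (\<integral>\<^sup>+x. ennreal ((B k x)\<^sup>2) \<partial>M)"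
      by (simp add: nn_integral_add nn_integral_cmult)
    finally show "(\<integral>\<^sup>+x. ennreal ((A k x + B k x)\<^sup>2) \<partial>M)
     \<le> 2 * (\<integral>\<^sup>+x. ennreal ((A k x)\<^sup>2) \<partial>M) + 2 * (\<integral>\<^sup>+x. ennreal ((B k x)\<^sup>2) \<partial>M)" .
  qed
  have "(\<lambda>k. 2 * (\<integral>\<^sup>+x. ennreal ((A k x)\<^sup>2) \<partial>M) + 2 * (\<integral>\<^sup>+x. ennreal ((B k x)\<^sup>2) \<partial>M)) \<longlonglongrightarrow> 2 * 0 + 2 * 0"
    by (intro tendsto_add ennreal_tendsto_cmult A B) auto
  then show "(\<lambda>k. 2 * (\<integral>\<^sup>+x. ennreal ((A k x)\<^sup>2) \<partial>M) + 2 * (\<integral>\<^sup>+x. ennreal ((B k x)\<^sup>2) \<partial>M)) \<longlonglongrightarrow> 0"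
    by simp
qed simp

lemma tendsto_nn_integral_square_cmult:
  fixes A :: "nat \<Rightarrow> 'a \<Rightarrow> real"
  assumes [measurable]: "\<And>k. A k \<in> borel_measurable M"
    and A: "(\<lambda>k. \<integral>\<^sup>+x. ennreal ((A k x)\<^sup>2) \<partial>M) \<longlonglongrightarrow> 0"
  shows "(\<lambda>k. \<integral>\<^sup>+x. ennreal ((c * A k x)\<^sup>2) \<partial>M) \<longlonglongrightarrow> 0"
proof -
  have "(\<integral>\<^sup>+x. ennreal ((c * A k x)\<^sup>2) \<partial>M) = ennreal (c\<^sup>2) * (\<integral>\<^sup>+x. ennreal ((A k x)\<^sup>2) \<partial>M)" for k
    by (simp add: power_mult_distrib ennreal_mult nn_integral_cmult)
  moreover have "(\<lambda>k. ennreal (c\<^sup>2) * (\<integral>\<^sup>+x. ennreal ((A k x)\<^sup>2) \<partial>M)) \<longlonglongrightarrow> ennreal (c\<^sup>2) * 0"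
    by (intro ennreal_tendsto_cmult A) auto
  ultimately show ?thesis by simp
qed

text \<open>Restricting the measure turns set integrals over [0, T] into plain integrals, so that
  the same lemmas on square integrable functions serve both for dt and for the probability
  measure.\<close>

definition interval_lebesgue :: "real \<Rightarrow> real measure" where
  "interval_lebesgue T = restrict_space lebesgue {0..T}"

lemma nn_integral_interval_lebesgue:
  "(\<integral>\<^sup>+t. f t \<partial>interval_lebesgue T) = (\<integral>\<^sup>+t\<in>{0..T}. f t \<partial>lebesgue)"
  unfolding interval_lebesgue_def by (subst nn_integral_restrict_space) auto

lemma lebesgue_integral_interval_lebesgue:
  "(LINT t|interval_lebesgue T. (f t :: real)) = (LINT t:{0..T}|lebesgue. f t)"
  unfolding interval_lebesgue_def set_lebesgue_integral_def by (subst integral_restrict_space) auto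

lemma integrable_interval_lebesgue:
  "integrable (interval_lebesgue T) (f :: real \<Rightarrow> real) \<longleftrightarrow> set_integrable lebesgue {0..T} f"
  unfolding interval_lebesgue_def set_integrable_def by (subst integrable_restrict_space) auto

lemma measurable_interval_lebesgue: "f \<in> borel_measurable lebesgue \<Longrightarrow> f \<in> borel_measurable (interval_lebesgue T)"
  unfolding interval_lebesgue_def by (rule measurable_restrict_space1)

lemma step_fun_measurable_interval: "step_fun X \<in> borel_measurable (interval_lebesgue T)"
  by (intro measurable_interval_lebesgue measurable_completion) measurable

lemma has_stochastic_integral_iff:
  "has_stochastic_integral M y T f I \<longleftrightarrow>
     f \<in> borel_measurable lebesgue \<and> I \<in> borel_measurable M \<and>
     (\<exists>X. (\<forall>k. steps_within T (X k)) \<and>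
       (\<lambda>k. \<integral>\<^sup>+t. ennreal ((step_fun (X k) t - f t)\<^sup>2) \<partial>interval_lebesgue T) \<longlonglongrightarrow> 0 \<and>
       (\<lambda>k. \<integral>\<^sup>+\<omega>. ennreal ((step_integral (X k) y \<omega> - I \<omega>)\<^sup>2) \<partial>M) \<longlonglongrightarrow> 0)"
  unfolding has_stochastic_integral_def nn_integral_interval_lebesgue ..

lemma has_stochastic_integral_zero: "has_stochastic_integral M y T (\<lambda>t. 0) (\<lambda>\<omega>. 0)"
  unfolding has_stochastic_integral_iff by (auto intro!: exI[of _ "\<lambda>_. []"])

lemma has_stochastic_integral_cmult:
  assumes y: "\<And>t. t \<in> {0..T} \<Longrightarrow> y t \<in> borel_measurable M"
    and I: "has_stochastic_integral M y T f I"
  shows "has_stochastic_integral M y T (\<lambda>t. c * f t) (\<lambda>\<omega>. c * I \<omega>)"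
proof -
  from I obtain X where f: "f \<in> borel_measurable lebesgue" and Im: "I \<in> borel_measurable M"
    and X: "\<And>k. steps_within T (X k)"
    and 1: "(\<lambda>k. \<integral>\<^sup>+t. ennreal ((step_fun (X k) t - f t)\<^sup>2) \<partial>interval_lebesgue T) \<longlonglongrightarrow> 0"
    and 2: "(\<lambda>k. \<integral>\<^sup>+\<omega>. ennreal ((step_integral (X k) y \<omega> - I \<omega>)\<^sup>2) \<partial>M) \<longlonglongrightarrow> 0"
    unfolding has_stochastic_integral_iff by blast
  let ?X = "\<lambda>k. map (\<lambda>(d, a, b). (c * d, a, b)) (X k)"
  have A: "steps_within T (?X k)" for k using X[of k] by fastforce
  have B: "(\<lambda>k. \<integral>\<^sup>+t. ennreal ((step_fun (?X k) t - c * f t)\<^sup>2) \<partial>interval_lebesgue T) \<longlonglongrightarrow> 0"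
    unfolding step_fun_scale right_diff_distrib[symmetric]
    by (rule tendsto_nn_integral_square_cmult[OF _ 1])
      (intro borel_measurable_diff step_fun_measurable_interval measurable_interval_lebesgue f)
  have C: "(\<lambda>k. \<integral>\<^sup>+\<omega>. ennreal ((step_integral (?X k) y \<omega> - c * I \<omega>)\<^sup>2) \<partial>M) \<longlonglongrightarrow> 0"
    unfolding step_integral_scale right_diff_distrib[symmetric]
    by (rule tendsto_nn_integral_square_cmult[OF _ 2])
      (intro borel_measurable_diff step_integral_measurable[OF y X] Im)
  have D: "(\<lambda>t. c * f t) \<in> borel_measurable lebesgue" "(\<lambda>\<omega>. c * I \<omega>) \<in> borel_measurable M"
    using f Im by auto
  show ?thesis unfolding has_stochastic_integral_iff
    by (intro conjI exI[of _ "?X"] allI A B C D)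
qed

lemma has_stochastic_integral_add:
  assumes y: "\<And>t. t \<in> {0..T} \<Longrightarrow> y t \<in> borel_measurable M"
    and I: "has_stochastic_integral M y T f I" and J: "has_stochastic_integral M y T g J"
  shows "has_stochastic_integral M y T (\<lambda>t. f t + g t) (\<lambda>\<omega>. I \<omega> + J \<omega>)"
proof -
  from I obtain X where f: "f \<in> borel_measurable lebesgue" and Im: "I \<in> borel_measurable M"
    and X: "\<And>k. steps_within T (X k)"
    and X1: "(\<lambda>k. \<integral>\<^sup>+t. ennreal ((step_fun (X k) t - f t)\<^sup>2) \<partial>interval_lebesgue T) \<longlonglongrightarrow> 0"
    and X2: "(\<lambda>k. \<integral>\<^sup>+\<omega>. ennreal ((step_integral (X k) y \<omega> - I \<omega>)\<^sup>2) \<partial>M) \<longlonglongrightarrow> 0"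
    unfolding has_stochastic_integral_iff by blast
  from J obtain Y where g: "g \<in> borel_measurable lebesgue" and Jm: "J \<in> borel_measurable M"
    and Y: "\<And>k. steps_within T (Y k)"
    and Y1: "(\<lambda>k. \<integral>\<^sup>+t. ennreal ((step_fun (Y k) t - g t)\<^sup>2) \<partial>interval_lebesgue T) \<longlonglongrightarrow> 0"
    and Y2: "(\<lambda>k. \<integral>\<^sup>+\<omega>. ennreal ((step_integral (Y k) y \<omega> - J \<omega>)\<^sup>2) \<partial>M) \<longlonglongrightarrow> 0"
    unfolding has_stochastic_integral_iff by blast
  have A: "steps_within T (X k @ Y k)" for k using X[of k] Y[of k] by fastforce
  have B: "(\<lambda>k. \<integral>\<^sup>+t. ennreal ((step_fun (X k @ Y k) t - (f t + g t))\<^sup>2) \<partial>interval_lebesgue T) \<longlonglongrightarrow> 0"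
    unfolding step_fun_append add_diff_add
    by (rule tendsto_nn_integral_square_add[OF _ _ X1 Y1])
      (intro borel_measurable_diff step_fun_measurable_interval measurable_interval_lebesgue f g)+
  have C: "(\<lambda>k. \<integral>\<^sup>+\<omega>. ennreal ((step_integral (X k @ Y k) y \<omega> - (I \<omega> + J \<omega>))\<^sup>2) \<partial>M) \<longlonglongrightarrow> 0"
    unfolding step_integral_append add_diff_add
    by (rule tendsto_nn_integral_square_add[OF _ _ X2 Y2])
      (rule borel_measurable_diff[OF step_integral_measurable[OF y X] Im]
        borel_measurable_diff[OF step_integral_measurable[OF y Y] Jm]; simp)+
  have D: "(\<lambda>t. f t + g t) \<in> borel_measurable lebesgue" "(\<lambda>\<omega>. I \<omega> + J \<omega>) \<in> borel_measurable M"
    using f g Im Jm by auto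
  show ?thesis unfolding has_stochastic_integral_iff
    by (intro conjI exI[of _ "\<lambda>k. X k @ Y k"] allI A B C D)
qed

text \<open>Through this linearity a bound for a single integrand yields the joint exponential
  moments of all the noise coefficients.\<close>

lemma has_stochastic_integral_sum:
  assumes y: "\<And>t. t \<in> {0..T} \<Longrightarrow> y t \<in> borel_measurable M"
    and "finite A" and "\<And>j. j \<in> A \<Longrightarrow> has_stochastic_integral M y T (f j) (I j)"
  shows "has_stochastic_integral M y T (\<lambda>t. \<Sum>j\<in>A. c j * f j t) (\<lambda>\<omega>. \<Sum>j\<in>A. c j * I j \<omega>)"
  using assms(2,3)
proof (induction A rule: finite_induct)
  case (insert j A)
  have "has_stochastic_integral M y T (\<lambda>t. c j * f j t + (\<Sum>j\<in>A. c j * f j t)) (\<lambda>\<omega>. c j * I j \<omega> + (\<Sum>j\<in>A. c j * I j \<omega>))"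
    by (rule has_stochastic_integral_add[OF y has_stochastic_integral_cmult[OF y]])
      (use insert in auto)
  with insert show ?case by simp
qed (simp add: has_stochastic_integral_zero)

section \<open>Limits of integrals under mean square convergence\<close>

lemma integrable_mult_L2:
  fixes f g :: "'a \<Rightarrow> real"
  assumes "f \<in> borel_measurable M" "g \<in> borel_measurable M"
    and "integrable M (\<lambda>x. (f x)\<^sup>2)" "integrable M (\<lambda>x. (g x)\<^sup>2)"
  shows "integrable M (\<lambda>x. f x * g x)"
proof (rule Bochner_Integration.integrable_bound[OF Bochner_Integration.integrable_add[OF assms(3,4)]])
  show "AE x in M. norm (f x * g x) \<le> norm ((f x)\<^sup>2 + (g x)\<^sup>2)"
  proof (intro AE_I2)
    fix x
    have "2 * (\<bar>f x\<bar> * \<bar>g x\<bar>) \<le> (f x)\<^sup>2 + (g x)\<^sup>2" using sum_squares_bound[of "\<bar>f x\<bar>" "\<bar>g x\<bar>"] by simp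
    moreover have "0 \<le> \<bar>f x\<bar> * \<bar>g x\<bar>" by simp
    ultimately show "norm (f x * g x) \<le> norm ((f x)\<^sup>2 + (g x)\<^sup>2)" unfolding real_norm_def abs_mult by linarith
  qed
qed (use assms in auto)

text \<open>A weighted form of the Cauchy-Schwarz inequality without square roots: pointwise it is
  (a |f| - |g|)^2 / a \<ge> 0. A large weight makes the part coming from g small.\<close>

lemma abs_integral_mult_le:
  fixes f g :: "'a \<Rightarrow> real"
  assumes "f \<in> borel_measurable M" "g \<in> borel_measurable M"
    and "integrable M (\<lambda>x. (f x)\<^sup>2)" "integrable M (\<lambda>x. (g x)\<^sup>2)" and a: "a > 0"
  shows "\<bar>LINT x|M. f x * g x\<bar> \<le> (a * (LINT x|M. (f x)\<^sup>2) + (LINT x|M. (g x)\<^sup>2) / a) / 2"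
proof -
  have "\<bar>LINT x|M. f x * g x\<bar> \<le> (LINT x|M. \<bar>f x * g x\<bar>)" by (rule integral_abs_bound)
  also have "\<dots> \<le> (LINT x|M. (a * (f x)\<^sup>2 + (g x)\<^sup>2 / a) / 2)"
  proof (rule integral_mono)
    fix x
    have "0 \<le> (a * \<bar>f x\<bar> - \<bar>g x\<bar>)\<^sup>2 / a" using a by simp
    also have "\<dots> = a * (f x)\<^sup>2 + (g x)\<^sup>2 / a - 2 * \<bar>f x * g x\<bar>"
    proof -
      have "(a * p - q)\<^sup>2 / a = a * p\<^sup>2 + q\<^sup>2 / a - 2 * (p * q)" for p q :: real
        using a by (simp add: field_simps power2_eq_square)
      from this[of "\<bar>f x\<bar>" "\<bar>g x\<bar>"] show ?thesis by (simp add: abs_mult)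
    qed
    finally show "\<bar>f x * g x\<bar> \<le> (a * (f x)\<^sup>2 + (g x)\<^sup>2 / a) / 2" by simp
  qed (use assms integrable_mult_L2[OF assms(1-4)] in auto)
  also have "\<dots> = (a * (LINT x|M. (f x)\<^sup>2) + (LINT x|M. (g x)\<^sup>2) / a) / 2"
    using assms by simp
  finally show ?thesis .
qed

lemma L2_tendsto_integral_mult:
  fixes u :: "nat \<Rightarrow> 'a \<Rightarrow> real" and f h :: "'a \<Rightarrow> real"
  assumes m: "\<And>k. u k \<in> borel_measurable M" "f \<in> borel_measurable M" "h \<in> borel_measurable M"
    and i: "\<And>k. integrable M (\<lambda>x. (u k x)\<^sup>2)" "integrable M (\<lambda>x. (f x)\<^sup>2)" "integrable M (\<lambda>x. (h x)\<^sup>2)"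
    and d: "(\<lambda>k. LINT x|M. (u k x - f x)\<^sup>2) \<longlonglongrightarrow> 0"
  shows "(\<lambda>k. LINT x|M. u k x * h x) \<longlonglongrightarrow> (LINT x|M. f x * h x)"
proof (rule LIMSEQ_I)
  fix e :: real assume e: "e > 0"
  define B where "B = (LINT x|M. (h x)\<^sup>2)"
  have B: "B \<ge> 0" unfolding B_def by simp
  \<comment> \<open>This weight brings the part coming from h below e; the other part is brought
    below e by taking k large, and the bound is half of their sum. The summand 1 covers B =
    0.\<close>
  define a where "a = (B + 1) / e"
  have a: "a > 0" using e B by (simp add: a_def)
  have Ba: "B / a \<le> e" using e B unfolding a_def by (simp add: field_simps)
  obtain K where K: "\<And>k. k \<ge> K \<Longrightarrow> norm ((LINT x|M. (u k x - f x)\<^sup>2) - 0) < e / a"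
    using LIMSEQ_D[OF d, of "e / a"] e a by auto
  show "\<exists>K. \<forall>k\<ge>K. norm ((LINT x|M. u k x * h x) - (LINT x|M. f x * h x)) < e"
  proof (intro exI allI impI)
    fix k assume k: "k \<ge> K"
    have ifk: "integrable M (\<lambda>x. (u k x - f x)\<^sup>2)"
      unfolding power2_diff using i integrable_mult_L2[OF m(1)[of k] m(2) i(1,2)]
      by (intro Bochner_Integration.integrable_add Bochner_Integration.integrable_diff) (auto simp: mult.assoc)
    have "(LINT x|M. u k x * h x) - (LINT x|M. f x * h x) = (LINT x|M. (u k x - f x) * h x)"
      unfolding left_diff_distrib
      by (rule Bochner_Integration.integral_diff[symmetric]) (intro integrable_mult_L2 m i)+
    moreover have "\<bar>LINT x|M. (u k x - f x) * h x\<bar> \<le> (a * (LINT x|M. (u k x - f x)\<^sup>2) + B / a) / 2"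
      unfolding B_def by (intro abs_integral_mult_le ifk i m borel_measurable_diff a)
    moreover have "a * (LINT x|M. (u k x - f x)\<^sup>2) < e"
      using K[OF k] a by (simp add: field_simps)
    ultimately show "norm ((LINT x|M. u k x * h x) - (LINT x|M. f x * h x)) < e"
      using Ba by simp
  qed
qed

lemma L2_tendsto_integral_square:
  fixes u :: "nat \<Rightarrow> 'a \<Rightarrow> real" and f :: "'a \<Rightarrow> real"
  assumes m: "\<And>k. u k \<in> borel_measurable M" "f \<in> borel_measurable M"
    and i: "\<And>k. integrable M (\<lambda>x. (u k x)\<^sup>2)" "integrable M (\<lambda>x. (f x)\<^sup>2)"
    and d: "(\<lambda>k. LINT x|M. (u k x - f x)\<^sup>2) \<longlonglongrightarrow> 0"
  shows "(\<lambda>k. LINT x|M. (u k x)\<^sup>2) \<longlonglongrightarrow> (LINT x|M. (f x)\<^sup>2)"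
proof -
  have "(LINT x|M. (u k x - f x)\<^sup>2) = (LINT x|M. (u k x)\<^sup>2) + (LINT x|M. (f x)\<^sup>2) - 2 * (LINT x|M. u k x * f x)" for k
    unfolding power2_diff using i integrable_mult_L2[OF m(1)[of k] m(2) i(1,2)]
    by (simp add: mult.assoc)
  then have eq: "(LINT x|M. (u k x)\<^sup>2) = (LINT x|M. (u k x - f x)\<^sup>2) - (LINT x|M. (f x)\<^sup>2) + 2 * (LINT x|M. u k x * f x)" for k
    by simp
  have "(\<lambda>k. (LINT x|M. (u k x - f x)\<^sup>2) - (LINT x|M. (f x)\<^sup>2) + 2 * (LINT x|M. u k x * f x))
    \<longlonglongrightarrow> 0 - (LINT x|M. (f x)\<^sup>2) + 2 * (LINT x|M. f x * f x)"
    by (intro tendsto_intros d L2_tendsto_integral_mult m i)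
  then show ?thesis unfolding eq by (simp add: power2_eq_square)
qed

lemma integrable_interval_const: "integrable (interval_lebesgue T) (\<lambda>t. c :: real)"
  unfolding integrable_interval_lebesgue by (rule absolutely_integrable_on_const) simp

lemma integrable_interval_of_square:
  fixes f :: "real \<Rightarrow> real"
  assumes "f \<in> borel_measurable lebesgue" "integrable (interval_lebesgue T) (\<lambda>t. (f t)\<^sup>2)"
  shows "integrable (interval_lebesgue T) f"
  using integrable_mult_L2[where g = "\<lambda>_. 1", OF measurable_interval_lebesgue[OF assms(1)] _ assms(2)]
    integrable_interval_const[of T 1] by simp

lemma integrable_step_fun_square: "integrable (interval_lebesgue T) (\<lambda>t. (step_fun X t)\<^sup>2)"
proof -
  have "set_integrable lebesgue {0..T} (\<lambda>t. step_fun (step_mult X X) t * 1)"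
    using integrable_interval_const[of T 1] unfolding integrable_interval_lebesgue
    by (rule step_fun_set_integrable)
  then show ?thesis unfolding integrable_interval_lebesgue by (simp add: step_fun_mult power2_eq_square)
qed

text \<open>Drift and noise separate pathwise. The identity for y is assumed at all times for one
  \<omega>, so a single null set will serve all step functions.\<close>

lemma step_integral_observation:
  assumes y: "\<And>t. t \<in> {0..T} \<Longrightarrow> y t \<omega> = y 0 \<omega> + (LINT s:{0..t}|lebesgue. S s) + (\<xi> t \<omega> - \<xi> 0 \<omega>)"
    and S: "set_integrable lebesgue {0..T} S" and X: "steps_within T X"
  shows "step_integral X y \<omega> = (LINT t|interval_lebesgue T. step_fun X t * S t) + step_integral X \<xi> \<omega>"
  using X
proof (induction X)
  case (Cons p X)
  obtain c a b where p: "p = (c, a, b)" by (metis surj_pair)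
  have ab: "0 \<le> a" "a \<le> b" "b \<le> T" using Cons.prems p by auto
  have i: "integrable (interval_lebesgue T) (\<lambda>t. step_fun Y t * S t)" for Y
    unfolding integrable_interval_lebesgue by (rule step_fun_set_integrable[OF S])
  have "(LINT t|interval_lebesgue T. c * indicator {a<..b} t * S t)
      = c * (LINT t|interval_lebesgue T. indicator {a<..b} t * S t)"
    by (simp only: mult.assoc integral_mult_right_zero)
  also have "(LINT t|interval_lebesgue T. indicator {a<..b} t * S t) = (LINT t:{a<..b}|lebesgue. S t)"
    unfolding lebesgue_integral_interval_lebesgue set_lebesgue_integral_def using ab
    by (intro Bochner_Integration.integral_cong refl) (auto simp: indicator_def)
  also have "\<dots> = (LINT t:{0..b}|lebesgue. S t) - (LINT t:{0..a}|lebesgue. S t)"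
  proof -
    have "set_integrable lebesgue {0..a} S" "set_integrable lebesgue {a<..b} S"
      using ab by (auto intro!: set_integrable_subset[OF S])
    moreover have "{0..b} = {0..a} \<union> {a<..b}" using ab by auto
    moreover have "{0..a} \<inter> {a<..b} = {}" by auto
    ultimately show ?thesis by (simp add: set_integral_Un)
  qed
  also have "\<dots> = (y b \<omega> - y a \<omega>) - (\<xi> b \<omega> - \<xi> a \<omega>)"
    using y[of a] y[of b] ab by simp
  finally have 1: "(LINT t|interval_lebesgue T. c * indicator {a<..b} t * S t)
     = c * (y b \<omega> - y a \<omega>) - c * (\<xi> b \<omega> - \<xi> a \<omega>)"
    by (simp only: right_diff_distrib)
  have "(LINT t|interval_lebesgue T. step_fun (p # X) t * S t)
    = (LINT t|interval_lebesgue T. c * indicator {a<..b} t * S t) + (LINT t|interval_lebesgue T. step_fun X t * S t)"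
    unfolding p step_fun_Cons distrib_right
    using i[of "[(c, a, b)]"] i[of X]
    by (intro Bochner_Integration.integral_add) (simp_all add: step_fun_Cons)
  with 1 Cons show ?case by (simp add: p step_integral_Cons)
qed simp

text \<open>Finitely many of the extended integrals may be infinite; the shift by K discards them,
  after which the convergence is one of real integrals.\<close>

lemma nn_integral_tendsto_zero_real:
  assumes m: "\<And>k. f k \<in> borel_measurable M" and nn: "\<And>k x. 0 \<le> (f k x :: real)"
    and lim: "(\<lambda>k. \<integral>\<^sup>+x. ennreal (f k x) \<partial>M) \<longlonglongrightarrow> 0"
  obtains K where "\<And>k. integrable M (f (k + K))" "(\<lambda>k. LINT x|M. f (k + K) x) \<longlonglongrightarrow> 0"
proof -
  have "eventually (\<lambda>k. (\<integral>\<^sup>+x. ennreal (f k x) \<partial>M) < 1) sequentially"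
    using order_tendstoD(2)[OF lim, of 1] by simp
  then obtain K where K: "\<And>k. k \<ge> K \<Longrightarrow> (\<integral>\<^sup>+x. ennreal (f k x) \<partial>M) < 1"
    unfolding eventually_sequentially by blast
  have i: "integrable M (f (k + K))" for k
    using K[of "k + K"] m nn by (intro integrableI_nonneg) (auto intro: order_less_trans)
  have "(\<lambda>k. enn2real (\<integral>\<^sup>+x. ennreal (f (k + K) x) \<partial>M)) \<longlonglongrightarrow> 0"
    using LIMSEQ_ignore_initial_segment[OF lim, of K]
    by (intro tendsto_enn2real) (simp_all only: ennreal_0 order_refl)
  moreover have "enn2real (\<integral>\<^sup>+x. ennreal (f (k + K) x) \<partial>M) = (LINT x|M. f (k + K) x)" for k
    using nn m by (subst integral_eq_nn_integral) auto
  ultimately have "(\<lambda>k. LINT x|M. f (k + K) x) \<longlonglongrightarrow> 0" by simp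
  with i show thesis by (rule that)
qed

text \<open>The subtracted integral of f S is the limit of the drift parts of the step integrals, so
  the exponent is the limit of step integrals against \<xi> alone, to which the bound for step
  functions applies.\<close>

lemma nn_integral_exp_stochastic_integral:
  assumes bm: "standard_brownian_motion M w" and ou: "ornstein_uhlenbeck M \<theta> w \<xi>" and th: "\<theta> \<le> 0"
    and obs: "observation M (real n) S \<xi> y" and I: "has_stochastic_integral M y (real n) f I"
    and Sm: "S \<in> borel_measurable lebesgue" and S2: "integrable (interval_lebesgue (real n)) (\<lambda>t. (S t)\<^sup>2)"
    and f2: "integrable (interval_lebesgue (real n)) (\<lambda>t. (f t)\<^sup>2)"
  shows "(\<integral>\<^sup>+\<omega>. ennreal (exp (I \<omega> - (LINT t|interval_lebesgue (real n). f t * S t))) \<partial>M)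
    \<le> ennreal (exp (1 / 2 * (LINT t|interval_lebesgue (real n). (f t)\<^sup>2)))"
proof -
  let ?L = "interval_lebesgue (real n)"
  have y: "y t \<in> borel_measurable M" if "t \<in> {0..real n}" for t
    using obs that unfolding observation_def by blast
  have \<xi>: "\<xi> t \<in> borel_measurable M" if "t \<in> {0..real n}" for t
    using ou that unfolding ornstein_uhlenbeck_def by simp
  obtain X where fm: "f \<in> borel_measurable lebesgue" and Im: "I \<in> borel_measurable M"
    and X: "\<And>k. steps_within (real n) (X k)"
    and lim1: "(\<lambda>k. \<integral>\<^sup>+t. ennreal ((step_fun (X k) t - f t)\<^sup>2) \<partial>?L) \<longlonglongrightarrow> 0"
    and lim2: "(\<lambda>k. \<integral>\<^sup>+\<omega>. ennreal ((step_integral (X k) y \<omega> - I \<omega>)\<^sup>2) \<partial>M) \<longlonglongrightarrow> 0"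
    using I unfolding has_stochastic_integral_iff by blast
  have XIm: "step_integral (X k) y \<in> borel_measurable M" "step_integral (X k) \<xi> \<in> borel_measurable M" for k
    using step_integral_measurable[of "real n" y M, OF y X]
      step_integral_measurable[of "real n" \<xi> M, OF \<xi> X] by auto
  have fL: "f \<in> borel_measurable ?L" and SL: "S \<in> borel_measurable ?L"
    using fm Sm by (auto intro: measurable_interval_lebesgue)
  obtain K where K: "\<And>k. integrable M (\<lambda>\<omega>. (step_integral (X (k + K)) y \<omega> - I \<omega>)\<^sup>2)"
    "(\<lambda>k. LINT \<omega>|M. (step_integral (X (k + K)) y \<omega> - I \<omega>)\<^sup>2) \<longlonglongrightarrow> 0"
  proof (rule nn_integral_tendsto_zero_real[OF _ _ lim2])
    show "(\<lambda>\<omega>. (step_integral (X k) y \<omega> - I \<omega>)\<^sup>2) \<in> borel_measurable M" for k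
      by (intro borel_measurable_power borel_measurable_diff XIm Im)
  qed (simp, rule that)
  \<comment> \<open>Mean square convergence gives almost sure convergence only along a subsequence,
    which is all that the Fatou argument asks for.\<close>
  obtain r where r: "strict_mono r" and
    ae: "AE \<omega> in M. (\<lambda>k. (step_integral (X (r k + K)) y \<omega> - I \<omega>)\<^sup>2) \<longlonglongrightarrow> 0"
    using tendsto_L1_AE_subseq[of M "\<lambda>k \<omega>. (step_integral (X (k + K)) y \<omega> - I \<omega>)\<^sup>2"] K by auto
  obtain K' where K': "(\<lambda>k. LINT t|?L. (step_fun (X (k + K')) t - f t)\<^sup>2) \<longlonglongrightarrow> 0"
  proof (rule nn_integral_tendsto_zero_real[OF _ _ lim1])
    show "(\<lambda>t. (step_fun (X k) t - f t)\<^sup>2) \<in> borel_measurable ?L" for k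
      by (intro borel_measurable_power borel_measurable_diff step_fun_measurable_interval fL)
  qed (simp, rule that)
  \<comment> \<open>The offset \<open>K'\<close> is undone, so that convergence on [0, n] can be
    read along the indices r k + K of the almost surely convergent subsequence.\<close>
  have "(\<lambda>k. LINT t|?L. (step_fun (X k) t - f t)\<^sup>2) \<longlonglongrightarrow> 0"
    by (rule LIMSEQ_offset[OF K'])
  then have "(\<lambda>k. LINT t|?L. (step_fun (X (k + K)) t - f t)\<^sup>2) \<longlonglongrightarrow> 0"
    by (rule LIMSEQ_ignore_initial_segment)
  from LIMSEQ_subseq_LIMSEQ[OF this r]
  have d: "(\<lambda>k. LINT t|?L. (step_fun (X (r k + K)) t - f t)\<^sup>2) \<longlonglongrightarrow> 0"
    unfolding o_def .
  define Z where "Z k = X (r k + K)" for k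
  have ZS: "(\<lambda>k. LINT t|?L. step_fun (Z k) t * S t) \<longlonglongrightarrow> (LINT t|?L. f t * S t)"
    unfolding Z_def by (intro L2_tendsto_integral_mult step_fun_measurable_interval fL SL
        integrable_step_fun_square f2 S2 d)
  have Z2: "(\<lambda>k. LINT t|?L. (step_fun (Z k) t)\<^sup>2) \<longlonglongrightarrow> (LINT t|?L. (f t)\<^sup>2)"
    unfolding Z_def by (intro L2_tendsto_integral_square step_fun_measurable_interval fL
        integrable_step_fun_square f2 d)
  have Si: "set_integrable lebesgue {0..real n} S"
    using integrable_interval_of_square[OF Sm S2] unfolding integrable_interval_lebesgue .
  have obs': "AE \<omega> in M. \<forall>t\<in>{0..real n}. y t \<omega> = y 0 \<omega> + (LINT s:{0..t}|lebesgue. S s) + (\<xi> t \<omega> - \<xi> 0 \<omega>)"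
    using obs unfolding observation_def by blast
  show ?thesis
  proof (rule nn_integral_Fatou_exp[where Y = "\<lambda>k. step_integral (Z k) \<xi>"
        and c = "\<lambda>k. 1 / 2 * (LINT t|?L. (step_fun (Z k) t)\<^sup>2)"])
    show "step_integral (Z k) \<xi> \<in> borel_measurable M" for k using XIm by (simp add: Z_def)
    show "(\<lambda>\<omega>. I \<omega> - (LINT t|?L. f t * S t)) \<in> borel_measurable M" using Im by simp
    show "AE \<omega> in M. (\<lambda>k. step_integral (Z k) \<xi> \<omega>) \<longlonglongrightarrow> I \<omega> - (LINT t|?L. f t * S t)"
      using ae obs'
    proof eventually_elim
      case (elim \<omega>)
      from tendsto_real_sqrt[OF elim(1)] have "(\<lambda>k. step_integral (Z k) y \<omega> - I \<omega>) \<longlonglongrightarrow> 0"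
        unfolding Z_def by (simp add: tendsto_rabs_zero_iff)
      then have "(\<lambda>k. step_integral (Z k) y \<omega>) \<longlonglongrightarrow> I \<omega>" by (simp add: LIM_zero_iff)
      from tendsto_diff[OF this ZS]
      have "(\<lambda>k. step_integral (Z k) y \<omega> - (LINT t|?L. step_fun (Z k) t * S t)) \<longlonglongrightarrow> I \<omega> - (LINT t|?L. f t * S t)" .
      moreover have "step_integral (Z k) y \<omega> - (LINT t|?L. step_fun (Z k) t * S t) = step_integral (Z k) \<xi> \<omega>" for k
      proof -
        have "steps_within (real n) (Z k)" unfolding Z_def by (rule X)
        from step_integral_observation[where y = y and \<xi> = \<xi>, OF _ Si this] elim(2)
        have "step_integral (Z k) y \<omega> = (LINT t|?L. step_fun (Z k) t * S t) + step_integral (Z k) \<xi> \<omega>"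
          by blast
        then show ?thesis by linarith
      qed
      ultimately show ?case by simp
    qed
    show "\<forall>\<^sub>F k in sequentially. (\<integral>\<^sup>+\<omega>. ennreal (exp (step_integral (Z k) \<xi> \<omega>)) \<partial>M)
      \<le> ennreal (exp (1 / 2 * (LINT t|?L. (step_fun (Z k) t)\<^sup>2)))"
    proof (intro always_eventually allI)
      fix k
      have "steps_within (real n) (Z k)" unfolding Z_def by (rule X)
      from nn_integral_exp_step_integral_ou[OF bm ou th this]
      show "(\<integral>\<^sup>+\<omega>. ennreal (exp (step_integral (Z k) \<xi> \<omega>)) \<partial>M)
        \<le> ennreal (exp (1 / 2 * (LINT t|?L. (step_fun (Z k) t)\<^sup>2)))"
        unfolding lebesgue_integral_interval_lebesgue .
    qed
    show "(\<lambda>k. 1 / 2 * (LINT t|?L. (step_fun (Z k) t)\<^sup>2)) \<longlonglongrightarrow> 1 / 2 * (LINT t|?L. (f t)\<^sup>2)"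
      by (rule tendsto_mult_left[OF Z2])
  qed
qed

section \<open>Integrals of periodic functions over n periods\<close>

lemma has_integral_periodic:
  fixes f :: "real \<Rightarrow> real"
  assumes "\<And>t. f (t + 1) = f t" and "(f has_integral I) {0..1}"
  shows "(f has_integral real n * I) {0..real n}"
proof (induction n)
  case (Suc n)
  have per: "f (t + real k) = f t" for t k
  proof (induction k)
    case (Suc k)
    have "f (t + real (Suc k)) = f ((t + real k) + 1)" by (simp add: algebra_simps)
    then show ?case using Suc assms(1) by simp
  qed simp
  have "((\<lambda>t. f (t + real n)) has_integral I) {0..1}" using assms(2) per by simp
  then have "(f has_integral I) {real n..real n + 1}"
    using has_integral_shift_Icc_real[of f "real n" I 0 1] by (simp add: add.commute o_def)
  from has_integral_combine[OF _ _ Suc this] show ?case by (simp add: algebra_simps)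
qed (simp add: has_integral_refl)

text \<open>The translation argument is made for the gauge integral; applying it to |f| as well
  recovers absolute integrability.\<close>

lemma periodic_interval_lebesgue:
  fixes f :: "real \<Rightarrow> real"
  assumes per: "\<And>t. f (t + 1) = f t" and i: "set_integrable lebesgue {0..1} f"
  shows "integrable (interval_lebesgue (real n)) f"
    and "(LINT t|interval_lebesgue (real n). f t) = real n * (LINT t:{0..1}|lebesgue. f t)"
proof -
  have a: "f absolutely_integrable_on {0..1}" using i .
  have h: "(f has_integral (LINT t:{0..1}|lebesgue. f t)) {0..1}"
    using a by (simp add: set_lebesgue_integral_eq_integral(2) absolutely_integrable_on_def integrable_integral)
  have "((\<lambda>t. \<bar>f t\<bar>) has_integral (integral {0..1} (\<lambda>t. \<bar>f t\<bar>))) {0..1}"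
    using a unfolding absolutely_integrable_on_def by (intro integrable_integral) simp
  from has_integral_periodic[OF _ this] per
  have "(\<lambda>t. \<bar>f t\<bar>) integrable_on {0..real n}" by (auto intro: has_integral_integrable)
  then have an: "f absolutely_integrable_on {0..real n}"
    using has_integral_periodic[OF per h, of n] unfolding absolutely_integrable_on_def
    by (auto intro: has_integral_integrable)
  then show "integrable (interval_lebesgue (real n)) f" unfolding integrable_interval_lebesgue .
  show "(LINT t|interval_lebesgue (real n). f t) = real n * (LINT t:{0..1}|lebesgue. f t)"
    unfolding lebesgue_integral_interval_lebesgue
    using set_lebesgue_integral_eq_integral(2)[OF an] integral_unique[OF has_integral_periodic[OF per h, of n]] by simp
qed

section \<open>The constants of the penalty\<close>

text \<open>The function z - 2 - ln z changes sign on [2, 4]. The root z found there is the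
  greatest: a root u > z would give u - z = ln (u / z) \<le> (u - z) / z < u - z, as z > 1. This
  also shows that \<open>GREATEST\<close> denotes a root.\<close>

lemma z_star_bounds: "2 \<le> z_star" "z_star \<le> 4"
proof -
  have "\<exists>z\<ge>2. z \<le> 4 \<and> z - 2 - ln z = (0::real)"
  proof (rule IVT')
    have "ln (4::real) = 2 * ln 2" using ln_realpow[of 2 2] by simp
    then show "(0::real) \<le> 4 - 2 - ln 4" using ln_le_minus_one[of "2::real"] by simp
    show "continuous_on {2..4} (\<lambda>z. z - 2 - ln z :: real)" by (intro continuous_intros) auto
  qed auto
  then obtain z :: real where z: "2 \<le> z" "z \<le> 4" "ln z = z - 2" by force
  have "z_star = z" unfolding z_star_def
  proof (rule Greatest_equality)
    show "0 < z \<and> ln z = z - 2" using z by simp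
    fix u :: real assume u: "0 < u \<and> ln u = u - 2"
    show "u \<le> z"
    proof (rule ccontr)
      assume "\<not> u \<le> z"
      then have uz: "u > z" by simp
      have "ln u - ln z = ln (u / z)" using u z by (simp add: ln_div)
      also have "\<dots> \<le> u / z - 1" using u z by (intro ln_le_minus_one) auto
      also have "\<dots> < u - z" using uz z by (simp add: field_simps mult_strict_left_mono)
          (smt (verit) mult_less_cancel_right2 mult.commute right_diff_distrib' mult_strict_right_mono)
      finally show False using u z by simp
    qed
  qed
  with z show "2 \<le> z_star" "z_star \<le> 4" by simp_all
qed

text \<open>The minimum of z^2 / (z - 1) over z > 1 is 4, attained at z = 2. This bound funds the
  absorption of the noise at the selected model.\<close>

lemma rho_two_ge: "32 \<le> rho 2"
proof -
  have "4 * (z_star - 1) \<le> z_star\<^sup>2"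
    using zero_le_power2[of "z_star - 2"] by (simp add: power2_diff)
  then show ?thesis using z_star_bounds unfolding rho_def by (simp add: field_simps)
qed

text \<open>Needed to fit twice the penalty of the comparison model into the term of
  \<open>b_hat\<close> with \<open>tau1\<close>.\<close>

lemma rho_two_le_tau1: "rho 2 \<le> tau1"
proof -
  have "0 \<le> (z_star - 2) * (8 * z_star + 3)" using z_star_bounds by (intro mult_nonneg_nonneg) auto
  then have "8 * z_star\<^sup>2 \<le> (3 + 16 * z_star) * (z_star - 1)"
    by (simp add: power2_eq_square algebra_simps)
  then show ?thesis using z_star_bounds unfolding rho_def tau1_def by (simp add: field_simps)
qed

text \<open>The ratio 9 / 8 is 36 / 32: the excess constants add up to 36, while twice
  \<open>tau0\<close> offers 32 times this quotient.\<close>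

lemma z_star_quotient_ge: "9 / 8 \<le> z_star / (z_star - 1)"
  using z_star_bounds by (simp add: field_simps)

section \<open>Chernoff bounds\<close>

text \<open>The weight doubles the variance of the Gaussian density, and the two normalisations
  differ by sqrt 2. The rate 1 / 4 stays below 1 / 2, where the integral diverges.\<close>

lemma nn_integral_normal_exp_square_quarter:
  "(\<integral>\<^sup>+g. ennreal (normal_density 0 1 g) * ennreal (exp (g\<^sup>2 / 4)) \<partial>lborel) = ennreal (sqrt 2)"
proof -
  have "normal_density 0 1 g * exp (g\<^sup>2 / 4) = sqrt 2 * normal_density 0 (sqrt 2) g" for g
  proof -
    have "exp (- g\<^sup>2 / 2) * exp (g\<^sup>2 / 4) = exp (- g\<^sup>2 / 4)"
      unfolding exp_add[symmetric] by simp
    then show ?thesis unfolding normal_density_def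
      by (simp add: real_sqrt_mult field_simps)
  qed
  then have "(\<integral>\<^sup>+g. ennreal (normal_density 0 1 g) * ennreal (exp (g\<^sup>2 / 4)) \<partial>lborel)
      = (\<integral>\<^sup>+g. ennreal (sqrt 2) * ennreal (normal_density 0 (sqrt 2) g) \<partial>lborel)"
    by (intro nn_integral_cong) (simp only: ennreal_mult'[symmetric] normal_density_nonneg exp_ge_zero real_sqrt_ge_zero zero_le_numeral)
  then show ?thesis by (simp add: nn_integral_cmult nn_integral_normal_density)
qed

text \<open>Each square is linearised by \<open>exp (x\<^sup>2 / 4) = E exp (g x / sqrt 2)\<close> with \<open>g\<close> standard
  normal, so that only the joint exponential moments of linear combinations are needed.\<close>

lemma nn_integral_exp_sum_squares:
  fixes x :: "'i \<Rightarrow> 'a \<Rightarrow> real"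
  assumes "prob_space M" and C: "finite C" and x: "\<And>j. j \<in> C \<Longrightarrow> x j \<in> borel_measurable M"
    and sub: "\<And>u. (\<integral>\<^sup>+\<omega>. ennreal (exp (\<Sum>j\<in>C. u j * x j \<omega>)) \<partial>M) \<le> ennreal (exp (1 / 2 * (\<Sum>j\<in>C. (u j)\<^sup>2)))"
  shows "(\<integral>\<^sup>+\<omega>. ennreal (exp (1 / 4 * (\<Sum>j\<in>C. (x j \<omega>)\<^sup>2))) \<partial>M) \<le> ennreal (sqrt 2 ^ card C)"
proof -
  interpret prob_space M by fact
  interpret pair_sigma_finite M lborel ..
  \<comment> \<open>The induction needs a linear form alongside the squares: each index in B carries
    a square still to be linearised, and u vanishes there so that its slot is free. The claim is the
    case B = C with u = 0.\<close>
  have "finite B \<Longrightarrow> B \<subseteq> C \<Longrightarrow> \<forall>j\<in>B. u j = 0 \<Longrightarrow>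
    (\<integral>\<^sup>+\<omega>. ennreal (exp ((\<Sum>j\<in>C. u j * x j \<omega>) + 1 / 4 * (\<Sum>j\<in>B. (x j \<omega>)\<^sup>2))) \<partial>M)
      \<le> ennreal (exp (1 / 2 * (\<Sum>j\<in>C. (u j)\<^sup>2))) * ennreal (sqrt 2 ^ card B)" for B u
  proof (induction B arbitrary: u rule: finite_induct)
    case empty
    then show ?case using sub[of u] by simp
  next
    case (insert b B)
    have b: "b \<in> C" "u b = 0" "B \<subseteq> C" using insert by auto
    \<comment> \<open>Since slot b was empty, filling it with g / sqrt 2 raises the sum of squares
      by exactly g^2 / 2. This gives a factor exp (g^2 / 4), whose average over g is sqrt 2.\<close>
    define v where "v g = u(b := g / sqrt 2)" for g :: real
    define q where "q \<omega> = (\<Sum>j\<in>B. (x j \<omega>)\<^sup>2)" for \<omega>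
    have v1: "(\<Sum>j\<in>C. v g j * x j \<omega>) = (\<Sum>j\<in>C. u j * x j \<omega>) + g / sqrt 2 * x b \<omega>" for g \<omega>
      using b C by (simp add: v_def sum.remove[of C b])
    have v2: "(\<Sum>j\<in>C. (v g j)\<^sup>2) = (\<Sum>j\<in>C. (u j)\<^sup>2) + g\<^sup>2 / 2" for g
      using b C by (simp add: v_def sum.remove[of C b] power_divide)
    have xb[measurable]: "x b \<in> borel_measurable M" using x b by simp
    have lin[measurable]: "(\<lambda>\<omega>. \<Sum>j\<in>C. u j * x j \<omega>) \<in> borel_measurable M"
      using x by (intro borel_measurable_sum) simp
    have qm[measurable]: "q \<in> borel_measurable M"
      unfolding q_def[abs_def] using x b by (intro borel_measurable_sum) auto
    have gauss: "ennreal (exp ((x b \<omega>)\<^sup>2 / 4))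
        = (\<integral>\<^sup>+g. ennreal (normal_density 0 1 g) * ennreal (exp (x b \<omega> / sqrt 2 * g)) \<partial>lborel)" for \<omega>
      using nn_integral_exp_normal_density[of 1 "x b \<omega> / sqrt 2"] by (simp add: power_divide)
    have split: "ennreal (exp ((\<Sum>j\<in>C. u j * x j \<omega>) + 1 / 4 * (\<Sum>j\<in>insert b B. (x j \<omega>)\<^sup>2)))
      = (\<integral>\<^sup>+g. ennreal (normal_density 0 1 g) * ennreal (exp ((\<Sum>j\<in>C. v g j * x j \<omega>) + 1 / 4 * q \<omega>)) \<partial>lborel)" for \<omega>
    proof -
      have "ennreal (exp ((\<Sum>j\<in>C. u j * x j \<omega>) + 1 / 4 * (\<Sum>j\<in>insert b B. (x j \<omega>)\<^sup>2)))
        = ennreal (exp ((\<Sum>j\<in>C. u j * x j \<omega>) + 1 / 4 * q \<omega>)) * ennreal (exp ((x b \<omega>)\<^sup>2 / 4))"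
        unfolding ennreal_mult'[OF exp_ge_zero, symmetric] exp_add[symmetric] q_def using insert by (simp add: algebra_simps)
      also have "\<dots> = (\<integral>\<^sup>+g. ennreal (exp ((\<Sum>j\<in>C. u j * x j \<omega>) + 1 / 4 * q \<omega>)) *
          (ennreal (normal_density 0 1 g) * ennreal (exp (x b \<omega> / sqrt 2 * g))) \<partial>lborel)"
        unfolding gauss by (subst nn_integral_cmult) auto
      also have "\<dots> = (\<integral>\<^sup>+g. ennreal (normal_density 0 1 g) * ennreal (exp ((\<Sum>j\<in>C. v g j * x j \<omega>) + 1 / 4 * q \<omega>)) \<partial>lborel)"
      proof (rule nn_integral_cong)
        fix g :: real
        have "exp ((\<Sum>j\<in>C. v g j * x j \<omega>) + 1 / 4 * q \<omega>) = exp ((\<Sum>j\<in>C. u j * x j \<omega>) + 1 / 4 * q \<omega>) * exp (x b \<omega> / sqrt 2 * g)"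
          unfolding exp_add[symmetric] v1 by (simp add: algebra_simps)
        then show "ennreal (exp ((\<Sum>j\<in>C. u j * x j \<omega>) + 1 / 4 * q \<omega>)) *
          (ennreal (normal_density 0 1 g) * ennreal (exp (x b \<omega> / sqrt 2 * g)))
          = ennreal (normal_density 0 1 g) * ennreal (exp ((\<Sum>j\<in>C. v g j * x j \<omega>) + 1 / 4 * q \<omega>))"
          by (simp only: ennreal_mult'[OF exp_ge_zero] mult.left_commute)
      qed
      finally show ?thesis .
    qed
    have "(\<integral>\<^sup>+\<omega>. ennreal (exp ((\<Sum>j\<in>C. u j * x j \<omega>) + 1 / 4 * (\<Sum>j\<in>insert b B. (x j \<omega>)\<^sup>2))) \<partial>M)
      = (\<integral>\<^sup>+\<omega>. (\<integral>\<^sup>+g. ennreal (normal_density 0 1 g) * ennreal (exp ((\<Sum>j\<in>C. v g j * x j \<omega>) + 1 / 4 * q \<omega>)) \<partial>lborel) \<partial>M)"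
      unfolding split ..
    also have "\<dots> = (\<integral>\<^sup>+g. (\<integral>\<^sup>+\<omega>. ennreal (normal_density 0 1 g) * ennreal (exp ((\<Sum>j\<in>C. v g j * x j \<omega>) + 1 / 4 * q \<omega>)) \<partial>M) \<partial>lborel)"
      unfolding v1 by (rule Fubini'[symmetric]) measurable
    also have "\<dots> \<le> (\<integral>\<^sup>+g. ennreal (exp (1 / 2 * (\<Sum>j\<in>C. (u j)\<^sup>2))) * ennreal (sqrt 2 ^ card B)
        * (ennreal (normal_density 0 1 g) * ennreal (exp (g\<^sup>2 / 4))) \<partial>lborel)"
    proof (rule nn_integral_mono)
      fix g :: real
      have "\<forall>j\<in>B. v g j = 0" using insert by (auto simp: v_def)
      from insert.IH[OF b(3) this]
      have "(\<integral>\<^sup>+\<omega>. ennreal (exp ((\<Sum>j\<in>C. v g j * x j \<omega>) + 1 / 4 * q \<omega>)) \<partial>M)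
        \<le> ennreal (exp (1 / 2 * (\<Sum>j\<in>C. (v g j)\<^sup>2))) * ennreal (sqrt 2 ^ card B)"
        unfolding q_def .
      also have "exp (1 / 2 * (\<Sum>j\<in>C. (v g j)\<^sup>2)) = exp (1 / 2 * (\<Sum>j\<in>C. (u j)\<^sup>2)) * exp (g\<^sup>2 / 4)"
        unfolding exp_add[symmetric] v2 by (simp add: algebra_simps)
      finally have le: "(\<integral>\<^sup>+\<omega>. ennreal (exp ((\<Sum>j\<in>C. v g j * x j \<omega>) + 1 / 4 * q \<omega>)) \<partial>M)
        \<le> ennreal (exp (1 / 2 * (\<Sum>j\<in>C. (u j)\<^sup>2))) * ennreal (exp (g\<^sup>2 / 4)) * ennreal (sqrt 2 ^ card B)"
        by (simp only: ennreal_mult'[OF exp_ge_zero])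
      have "(\<integral>\<^sup>+\<omega>. ennreal (normal_density 0 1 g) * ennreal (exp ((\<Sum>j\<in>C. v g j * x j \<omega>) + 1 / 4 * q \<omega>)) \<partial>M)
        = ennreal (normal_density 0 1 g) * (\<integral>\<^sup>+\<omega>. ennreal (exp ((\<Sum>j\<in>C. v g j * x j \<omega>) + 1 / 4 * q \<omega>)) \<partial>M)"
        unfolding v1 by (rule nn_integral_cmult) measurable
      also have "\<dots> \<le> ennreal (normal_density 0 1 g) *
         (ennreal (exp (1 / 2 * (\<Sum>j\<in>C. (u j)\<^sup>2))) * ennreal (exp (g\<^sup>2 / 4)) * ennreal (sqrt 2 ^ card B))"
        by (rule mult_left_mono[OF le]) simp
      finally show "(\<integral>\<^sup>+\<omega>. ennreal (normal_density 0 1 g) * ennreal (exp ((\<Sum>j\<in>C. v g j * x j \<omega>) + 1 / 4 * q \<omega>)) \<partial>M)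
        \<le> ennreal (exp (1 / 2 * (\<Sum>j\<in>C. (u j)\<^sup>2))) * ennreal (sqrt 2 ^ card B)
        * (ennreal (normal_density 0 1 g) * ennreal (exp (g\<^sup>2 / 4)))"
        by (simp only: mult_ac)
    qed
    also have "\<dots> = ennreal (exp (1 / 2 * (\<Sum>j\<in>C. (u j)\<^sup>2))) * ennreal (sqrt 2 ^ card B) * ennreal (sqrt 2)"
      unfolding nn_integral_normal_exp_square_quarter[symmetric] by (rule nn_integral_cmult) measurable
    also have "\<dots> = ennreal (exp (1 / 2 * (\<Sum>j\<in>C. (u j)\<^sup>2))) * ennreal (sqrt 2 ^ card (insert b B))"
      using insert by (simp add: ennreal_mult'[symmetric] mult_ac)
    finally show ?case .
  qed
  from this[OF C subset_refl, of "\<lambda>_. 0"] show ?thesis by simp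
qed

text \<open>\<open>ennreal\<close> sends negative reals to 0, so the left side integrates a positive
  part. It is dominated through t \<le> 4 (1 + t / 4) \<le> 4 exp (t / 4) at t = Q - p.\<close>

lemma nn_integral_positive_part_le:
  fixes Q :: "'a \<Rightarrow> real"
  assumes [measurable]: "Q \<in> borel_measurable M" and c: "0 \<le> c" and K: "0 \<le> K"
    and Q: "(\<integral>\<^sup>+\<omega>. ennreal (exp (1 / 4 * Q \<omega>)) \<partial>M) \<le> ennreal K"
  shows "(\<integral>\<^sup>+\<omega>. ennreal (c * (Q \<omega> - p)) \<partial>M) \<le> ennreal (4 * c * (exp (- p / 4) * K))"
proof -
  have "(\<integral>\<^sup>+\<omega>. ennreal (c * (Q \<omega> - p)) \<partial>M) \<le> (\<integral>\<^sup>+\<omega>. ennreal (4 * c * exp (- p / 4)) * ennreal (exp (1 / 4 * Q \<omega>)) \<partial>M)"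
  proof (rule nn_integral_mono)
    fix \<omega>
    have "Q \<omega> - p \<le> 4 * (1 + (Q \<omega> - p) / 4)" by (simp add: field_simps)
    also have "\<dots> \<le> 4 * exp ((Q \<omega> - p) / 4)" by (rule mult_left_mono[OF exp_ge_add_one_self]) simp
    also have "exp ((Q \<omega> - p) / 4) = exp (- p / 4) * exp (1 / 4 * Q \<omega>)"
      unfolding exp_add[symmetric] by (simp add: diff_divide_distrib)
    finally have "c * (Q \<omega> - p) \<le> c * (4 * (exp (- p / 4) * exp (1 / 4 * Q \<omega>)))" using c by (rule mult_left_mono)
    then show "ennreal (c * (Q \<omega> - p)) \<le> ennreal (4 * c * exp (- p / 4)) * ennreal (exp (1 / 4 * Q \<omega>))"
      unfolding ennreal_mult''[OF exp_ge_zero, symmetric] by (intro ennreal_leI) (simp add: mult_ac)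
  qed
  also have "\<dots> = ennreal (4 * c * exp (- p / 4)) * (\<integral>\<^sup>+\<omega>. ennreal (exp (1 / 4 * Q \<omega>)) \<partial>M)"
    by (rule nn_integral_cmult) measurable
  also have "\<dots> \<le> ennreal (4 * c * exp (- p / 4)) * ennreal K" by (rule mult_left_mono[OF Q]) simp
  also have "\<dots> = ennreal (4 * c * (exp (- p / 4) * K))"
    unfolding ennreal_mult''[OF K, symmetric] by (simp add: mult_ac)
  finally show ?thesis .
qed

text \<open>For l \<ge> 1 the price sqrt 2 per dimension is at most exp (l d / 2). The factor 3 / 2
  is 6 / 4, the threshold 6 l d for the sum of squares at rate 1 / 4.\<close>

lemma sqrt_two_power_le:
  assumes "1 \<le> l"
  shows "exp (- (3 / 2 * (l * real d))) * sqrt 2 ^ d \<le> exp (- l * real d)"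
proof -
  have "(2::real) \<le> exp 1" using exp_ge_add_one_self[of "1::real"] by simp
  also have "exp 1 = (exp (1 / 2 :: real))\<^sup>2" by (simp add: power2_eq_square exp_add[symmetric])
  finally have "sqrt 2 \<le> exp (1 / 2)" by (intro real_le_lsqrt) simp_all
  then have "sqrt 2 ^ d \<le> exp (1 / 2) ^ d" by (rule power_mono) simp
  also have "\<dots> = exp (real d * (1 / 2))" by (rule exp_of_nat_mult[symmetric])
  also have "\<dots> \<le> exp (1 / 2 * (l * real d))" using mult_right_mono[OF assms, of "real d"] by simp
  finally have "exp (- (3 / 2 * (l * real d))) * sqrt 2 ^ d \<le> exp (- (3 / 2 * (l * real d))) * exp (1 / 2 * (l * real d))"
    by (rule mult_left_mono) simp
  also have "\<dots> = exp (- l * real d)" unfolding exp_add[symmetric] by simp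
  finally show ?thesis .
qed

section \<open>Orthonormal expansions and model selection\<close>

lemma inner_L2_eq: "inner_L2 x z = (LINT t|interval_lebesgue 1. x t * z t)"
  unfolding inner_L2_def lebesgue_integral_interval_lebesgue ..

lemma periodic_L2_measurable: "periodic_L2 x \<Longrightarrow> x \<in> borel_measurable (interval_lebesgue T)"
  unfolding periodic_L2_def by (auto intro: measurable_interval_lebesgue)

lemma periodic_L2_integrable_mult:
  assumes "periodic_L2 x" "periodic_L2 z"
  shows "integrable (interval_lebesgue 1) (\<lambda>t. x t * z t)"
  using assms by (intro integrable_mult_L2 periodic_L2_measurable)
    (auto simp: periodic_L2_def integrable_interval_lebesgue)

lemma periodic_L2_interval:
  assumes "periodic_L2 x" "periodic_L2 z"
  shows "integrable (interval_lebesgue (real n)) (\<lambda>t. x t * z t)"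
    and "(LINT t|interval_lebesgue (real n). x t * z t) = real n * inner_L2 x z"
proof -
  have per: "x (t + 1) * z (t + 1) = x t * z t" for t using assms unfolding periodic_L2_def by simp
  have i: "set_integrable lebesgue {0..1} (\<lambda>t. x t * z t)"
    using periodic_L2_integrable_mult[OF assms] unfolding integrable_interval_lebesgue .
  show "integrable (interval_lebesgue (real n)) (\<lambda>t. x t * z t)"
    "(LINT t|interval_lebesgue (real n). x t * z t) = real n * inner_L2 x z"
    using periodic_interval_lebesgue[of "\<lambda>t. x t * z t" n, OF per i] unfolding inner_L2_def by auto
qed

lemma periodic_L2_zero: "periodic_L2 (\<lambda>t. 0)"
  by (simp add: periodic_L2_def set_integrable_def)

lemma periodic_L2_add:
  assumes x: "periodic_L2 x" and z: "periodic_L2 z"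
  shows "periodic_L2 (\<lambda>t. x t + z t)"
proof -
  have "integrable (interval_lebesgue 1) (\<lambda>t. x t * x t + 2 * (x t * z t) + z t * z t)"
    using periodic_L2_integrable_mult x z by (intro Bochner_Integration.integrable_add integrable_mult_right) blast+
  moreover have "(x t + z t)\<^sup>2 = x t * x t + 2 * (x t * z t) + z t * z t" for t
    by (simp add: power2_eq_square algebra_simps)
  ultimately show ?thesis
    using x z unfolding periodic_L2_def integrable_interval_lebesgue[symmetric]
    by (intro conjI borel_measurable_add) simp_all
qed

lemma periodic_L2_cmult:
  assumes "periodic_L2 x"
  shows "periodic_L2 (\<lambda>t. c * x t)"
  using assms unfolding periodic_L2_def integrable_interval_lebesgue[symmetric]
  by (intro conjI borel_measurable_times borel_measurable_const) (simp_all add: power_mult_distrib)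

lemma inner_L2_add_left:
  "periodic_L2 x \<Longrightarrow> periodic_L2 z \<Longrightarrow> periodic_L2 v \<Longrightarrow> inner_L2 (\<lambda>t. x t + z t) v = inner_L2 x v + inner_L2 z v"
  unfolding inner_L2_eq distrib_right
  by (intro Bochner_Integration.integral_add periodic_L2_integrable_mult)

lemma inner_L2_cmult_left: "inner_L2 (\<lambda>t. c * x t) v = c * inner_L2 x v"
  unfolding inner_L2_eq mult.assoc by simp

lemma inner_L2_commute: "inner_L2 x z = inner_L2 z x"
  unfolding inner_L2_eq by (simp only: mult.commute)

lemma periodic_L2_sum:
  assumes "finite A" "\<And>j. j \<in> A \<Longrightarrow> periodic_L2 (f j)"
  shows "periodic_L2 (\<lambda>t. \<Sum>j\<in>A. c j * f j t)"
  using assms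
proof (induction A rule: finite_induct)
  case (insert j A)
  then have "periodic_L2 (\<lambda>t. c j * f j t + (\<Sum>j\<in>A. c j * f j t))"
    by (intro periodic_L2_add periodic_L2_cmult) auto
  with insert show ?case by simp
qed (simp add: periodic_L2_zero)

lemma inner_L2_sum_left:
  assumes "finite A" "\<And>j. j \<in> A \<Longrightarrow> periodic_L2 (f j)" "periodic_L2 v"
  shows "inner_L2 (\<lambda>t. \<Sum>j\<in>A. c j * f j t) v = (\<Sum>j\<in>A. c j * inner_L2 (f j) v)"
  using assms
proof (induction A rule: finite_induct)
  case (insert j A)
  then have "inner_L2 (\<lambda>t. c j * f j t + (\<Sum>j\<in>A. c j * f j t)) v
      = inner_L2 (\<lambda>t. c j * f j t) v + inner_L2 (\<lambda>t. \<Sum>j\<in>A. c j * f j t) v"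
    by (intro inner_L2_add_left periodic_L2_cmult periodic_L2_sum) auto
  with insert show ?case by (simp add: inner_L2_cmult_left)
qed (simp add: inner_L2_eq)

lemma orthonormal_systemD:
  assumes "orthonormal_system \<phi>" "A \<subseteq> {1..}"
  shows "\<And>j. j \<in> A \<Longrightarrow> periodic_L2 (\<phi> j)"
    and "\<And>i j. i \<in> A \<Longrightarrow> j \<in> A \<Longrightarrow> inner_L2 (\<phi> i) (\<phi> j) = (if i = j then 1 else 0)"
proof -
  have ge: "1 \<le> j" if "j \<in> A" for j using assms(2) that by auto
  show "\<And>j. j \<in> A \<Longrightarrow> periodic_L2 (\<phi> j)"
    "\<And>i j. i \<in> A \<Longrightarrow> j \<in> A \<Longrightarrow> inner_L2 (\<phi> i) (\<phi> j) = (if i = j then 1 else 0)"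
    using assms(1) ge unfolding orthonormal_system_def by blast+
qed

lemma inner_L2_orthonormal_sum:
  assumes "orthonormal_system \<phi>" "finite A" "A \<subseteq> {1..}"
  shows "inner_L2 (\<lambda>t. \<Sum>j\<in>A. c j * \<phi> j t) (\<lambda>t. \<Sum>j\<in>A. c j * \<phi> j t) = (\<Sum>j\<in>A. (c j)\<^sup>2)"
proof -
  note on = orthonormal_systemD[OF assms(1,3)]
  have coef: "inner_L2 (\<phi> i) (\<lambda>t. \<Sum>j\<in>A. c j * \<phi> j t) = c i" if "i \<in> A" for i
  proof -
    have "inner_L2 (\<phi> i) (\<lambda>t. \<Sum>j\<in>A. c j * \<phi> j t) = (\<Sum>j\<in>A. c j * inner_L2 (\<phi> j) (\<phi> i))"
      by (subst inner_L2_commute) (intro inner_L2_sum_left assms on that)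
    also have "\<dots> = (\<Sum>j\<in>A. if j = i then c j else 0)"
      by (intro sum.cong refl) (simp add: on that)
    finally show ?thesis using that assms(2) by simp
  qed
  have "inner_L2 (\<lambda>t. \<Sum>j\<in>A. c j * \<phi> j t) (\<lambda>t. \<Sum>j\<in>A. c j * \<phi> j t)
     = (\<Sum>j\<in>A. c j * inner_L2 (\<phi> j) (\<lambda>t. \<Sum>j\<in>A. c j * \<phi> j t))"
    by (intro inner_L2_sum_left periodic_L2_sum assms on)
  then show ?thesis by (simp add: coef power2_eq_square)
qed

lemma normsq_L2_orthonormal_diff:
  assumes on: "orthonormal_system \<phi>" and A: "finite A" "A \<subseteq> {1..}" and S: "periodic_L2 S"
  shows "normsq_L2 (\<lambda>t. (\<Sum>j\<in>A. c j * \<phi> j t) - S t)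
    = normsq_L2 S - 2 * (\<Sum>j\<in>A. c j * inner_L2 S (\<phi> j)) + (\<Sum>j\<in>A. (c j)\<^sup>2)"
proof -
  define f where "f t = (\<Sum>j\<in>A. c j * \<phi> j t)" for t
  have f: "periodic_L2 f" unfolding f_def[abs_def]
    by (rule periodic_L2_sum[OF A(1)]) (rule orthonormal_systemD[OF on A(2)])
  have "normsq_L2 (\<lambda>t. f t - S t) = (LINT t|interval_lebesgue 1. f t * f t - 2 * (f t * S t) + S t * S t)"
    unfolding normsq_L2_def inner_L2_eq
    by (intro Bochner_Integration.integral_cong refl) (simp add: algebra_simps)
  also have "\<dots> = inner_L2 f f - 2 * inner_L2 f S + inner_L2 S S"
    unfolding inner_L2_eq using periodic_L2_integrable_mult f S by simp
  also have "inner_L2 f f = (\<Sum>j\<in>A. (c j)\<^sup>2)"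
    unfolding f_def[abs_def] by (rule inner_L2_orthonormal_sum[OF on A])
  also have "inner_L2 f S = (\<Sum>j\<in>A. c j * inner_L2 S (\<phi> j))"
    unfolding f_def[abs_def] inner_L2_commute[of S]
    by (rule inner_L2_sum_left[OF A(1) _ S]) (rule orthonormal_systemD[OF on A(2)])
  finally show ?thesis by (simp add: f_def normsq_L2_def)
qed

lemma normsq_L2_nonneg: "0 \<le> normsq_L2 x"
  unfolding normsq_L2_def inner_L2_eq by (rule Bochner_Integration.integral_nonneg) simp

lemma normsq_L2_proj_on_diff:
  assumes "orthonormal_system \<phi>" "finite m" "m \<subseteq> {1..}" "periodic_L2 S"
  shows "normsq_L2 (\<lambda>t. proj_on \<phi> S m t - S t) = normsq_L2 S - (\<Sum>j\<in>m. (inner_L2 S (\<phi> j))\<^sup>2)"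
  unfolding proj_on_def normsq_L2_orthonormal_diff[OF assms] by (simp add: power2_eq_square)

lemma Bessel_inequality:
  assumes "orthonormal_system \<phi>" "finite m" "m \<subseteq> {1..}" "periodic_L2 S"
  shows "(\<Sum>j\<in>m. (inner_L2 S (\<phi> j))\<^sup>2) \<le> normsq_L2 S"
  using normsq_L2_proj_on_diff[OF assms] normsq_L2_nonneg[of "\<lambda>t. proj_on \<phi> S m t - S t"] by simp

section \<open>The deterministic side of model selection\<close>

lemma contrast_alpha_hat:
  assumes "orthonormal_system \<phi>" "finite m" "m \<subseteq> {1..}"
  shows "contrast n \<phi> J m (\<lambda>j. alpha_hat n J j \<omega>) \<omega> = - (\<Sum>j\<in>m. (alpha_hat n J j \<omega>)\<^sup>2)"
proof -
  have "2 / real n * (\<Sum>j\<in>m. alpha_hat n J j \<omega> * J j \<omega>) = 2 * (\<Sum>j\<in>m. (alpha_hat n J j \<omega>)\<^sup>2)"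
    by (simp add: alpha_hat_def sum_distrib_left power2_eq_square)
  then show ?thesis unfolding contrast_def normsq_L2_def inner_L2_orthonormal_sum[OF assms] by simp
qed

text \<open>The error \<open>e j\<close> of the \<open>j\<close>-th coefficient is \<open>x j / sqrt n\<close>, and \<open>Z\<close> is the noise in the
  unit direction of the difference of the projections on \<open>m'\<close> and \<open>m\<close> (\<open>Z = 0\<close> if these coincide).\<close>

lemma penalised_selection_bound:
  fixes s x :: "nat \<Rightarrow> real" and m m' :: "nat set" and n :: nat
  defines "v j \<equiv> (if j \<in> m' then s j else 0) - (if j \<in> m then s j else 0)"
  defines "Z \<equiv> (\<Sum>j\<in>m \<union> m'. v j / sqrt (\<Sum>j\<in>m \<union> m'. (v j)\<^sup>2) * x j)"
  assumes fin: "finite m" "finite m'" and n: "n \<ge> 1"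
    and Bessel: "(\<Sum>j\<in>m \<union> m'. (s j)\<^sup>2) \<le> N"
    and a: "\<And>j. a j = s j + x j / sqrt (real n)"
    and sel: "P' - (\<Sum>j\<in>m'. (a j)\<^sup>2) \<le> P - (\<Sum>j\<in>m. (a j)\<^sup>2)"
  shows "N - 2 * (\<Sum>j\<in>m'. a j * s j) + (\<Sum>j\<in>m'. (a j)\<^sup>2)
    \<le> 3 * (N - (\<Sum>j\<in>m. (s j)\<^sup>2)) + 2 * P - 2 * P' + (3 * (\<Sum>j\<in>m'. (x j)\<^sup>2) + 4 * Z\<^sup>2) / real n"
proof -
  let ?U = "m \<union> m'"
  define e where "e j = x j / sqrt (real n)" for j
  have aj: "a j = s j + e j" for j using a by (simp add: e_def)
  define V where "V = (\<Sum>j\<in>m'. (e j)\<^sup>2)"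
  define C where "C A = (\<Sum>j\<in>A. s j * e j)" for A
  define b where "b A = N - (\<Sum>j\<in>A. (s j)\<^sup>2)" for A
  have sq: "(\<Sum>j\<in>A. (a j)\<^sup>2) = (\<Sum>j\<in>A. (s j)\<^sup>2) + 2 * C A + (\<Sum>j\<in>A. (e j)\<^sup>2)" for A
    unfolding aj C_def by (simp add: power2_sum sum.distrib sum_distrib_left algebra_simps)
  have "(\<Sum>j\<in>m'. a j * s j) = (\<Sum>j\<in>m'. (s j)\<^sup>2) + C m'"
    unfolding aj C_def by (simp add: power2_eq_square sum.distrib algebra_simps)
  then have loss: "N - 2 * (\<Sum>j\<in>m'. a j * s j) + (\<Sum>j\<in>m'. (a j)\<^sup>2) = b m' + V"
    unfolding sq b_def V_def by simp
  define \<sigma> where "\<sigma> = sqrt (\<Sum>j\<in>?U. (v j)\<^sup>2)"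
  have \<sigma>2: "\<sigma>\<^sup>2 = (\<Sum>j\<in>?U. (v j)\<^sup>2)" unfolding \<sigma>_def by (simp add: sum_nonneg)
  \<comment> \<open>The squared distance of the two projections is the energy of s on the symmetric
    difference of m and m'. Bessel on the union bounds it by b m + b m', with factor 1 where the
    triangle inequality would give 2.\<close>
  have "\<sigma>\<^sup>2 \<le> (\<Sum>j\<in>?U. 2 * (s j)\<^sup>2 - (if j \<in> m' then (s j)\<^sup>2 else 0) - (if j \<in> m then (s j)\<^sup>2 else 0))"
    unfolding \<sigma>2 by (intro sum_mono) (auto simp: v_def)
  also have "\<dots> = 2 * (\<Sum>j\<in>?U. (s j)\<^sup>2) - (\<Sum>j\<in>m'. (s j)\<^sup>2) - (\<Sum>j\<in>m. (s j)\<^sup>2)"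
    using fin by (simp add: sum_subtractf sum_distrib_left sum.inter_restrict[symmetric] Int_absorb1 Int_Un_distrib Int_Un_distrib2 inf.absorb_iff2 Un_Int_eq)
  finally have \<sigma>b: "\<sigma>\<^sup>2 \<le> b m + b m'" using Bessel unfolding b_def by linarith
  have CC: "C m' - C m = (\<Sum>j\<in>?U. v j * e j)"
  proof -
    have "C m' = (\<Sum>j\<in>?U. if j \<in> m' then s j * e j else 0)" "C m = (\<Sum>j\<in>?U. if j \<in> m then s j * e j else 0)"
      unfolding C_def using fin by (auto simp: sum.inter_restrict[symmetric] intro!: sum.cong)
    then show ?thesis unfolding sum_subtractf[symmetric]
      by (simp only: sum_subtractf[symmetric], intro sum.cong) (auto simp: v_def)
  qed
  have CZ: "(\<Sum>j\<in>?U. v j * e j) = \<sigma> * Z / sqrt (real n)"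
  proof (cases "\<sigma> = 0")
    case True
    then have "(\<Sum>j\<in>?U. (v j)\<^sup>2) = 0" using \<sigma>2 by simp
    then have "\<forall>j\<in>?U. v j = 0" using fin by (simp add: sum_nonneg_eq_0_iff)
    then show ?thesis using True by simp
  next
    case False
    have "\<sigma> * Z / sqrt (real n) = (\<Sum>j\<in>?U. \<sigma> * (v j / \<sigma> * x j) / sqrt (real n))"
      unfolding Z_def \<sigma>_def[symmetric] by (simp only: sum_distrib_left sum_divide_distrib)
    also have "\<dots> = (\<Sum>j\<in>?U. v j * e j)" using False by (intro sum.cong refl) (simp add: e_def)
    finally show ?thesis ..
  qed
  define y where "y = Z / sqrt (real n)"
  have y2: "y\<^sup>2 = Z\<^sup>2 / real n" by (simp add: y_def power_divide)
  have "C m' - C m = \<sigma> * y" unfolding CC CZ y_def by simp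
  moreover have "4 * (\<sigma> * y) \<le> \<sigma>\<^sup>2 + 4 * y\<^sup>2"
    using zero_le_power2[of "\<sigma> - 2 * y"] by (simp add: power2_diff power_mult_distrib)
  ultimately have cross: "4 * C m' - 4 * C m \<le> \<sigma>\<^sup>2 + 4 * y\<^sup>2"
    by (simp add: right_diff_distrib[symmetric])
  have "0 \<le> (\<Sum>j\<in>m. (e j)\<^sup>2)" by (simp add: sum_nonneg)
  then have "b m' - V - 2 * C m' + P' \<le> b m - 2 * C m + P"
    using sel unfolding sq b_def V_def by linarith
  \<comment> \<open>Twice the selection inequality bounds 2 b m'. The cross term returns one b m'
    and one b m, whence the factor 3 at b m; adding V to the 2 V already present gives the factor 3
    at V.\<close>
  then have "b m' + V \<le> 3 * b m + 2 * P - 2 * P' + 3 * V + 4 * y\<^sup>2"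
    using cross \<sigma>b by linarith
  moreover have "V = (\<Sum>j\<in>m'. (x j)\<^sup>2) / real n"
    unfolding V_def e_def by (simp add: power_divide sum_divide_distrib)
  ultimately show ?thesis unfolding loss y2 b_def by (simp add: add_divide_distrib)
qed

text \<open>The exponent is the centred integral of the sum of u_j \<phi>_j / sqrt n. Over n periods
  the squared norm of this function is the sum of the u_j^2, which is why the noise is scaled by
  sqrt n.\<close>

lemma nn_integral_exp_coefficient_noise:
  fixes u :: "nat \<Rightarrow> real"
  assumes bm: "standard_brownian_motion M w" and ou: "ornstein_uhlenbeck M \<theta> w \<xi>" and th: "\<theta> \<le> 0"
    and obs: "observation M (real n) S \<xi> y" and S: "periodic_L2 S" and n: "n \<ge> 1"
    and on: "orthonormal_system \<phi>" and A: "finite A" "A \<subseteq> {1..}"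
    and J: "\<And>j. j \<in> A \<Longrightarrow> has_stochastic_integral M y (real n) (\<phi> j) (J j)"
  shows "(\<integral>\<^sup>+\<omega>. ennreal (exp (\<Sum>j\<in>A. u j * ((J j \<omega> - real n * inner_L2 S (\<phi> j)) / sqrt (real n)))) \<partial>M)
    \<le> ennreal (exp (1 / 2 * (\<Sum>j\<in>A. (u j)\<^sup>2)))"
proof -
  define c where "c j = u j / sqrt (real n)" for j
  define f where "f t = (\<Sum>j\<in>A. c j * \<phi> j t)" for t
  note \<phi> = orthonormal_systemD(1)[OF on A(2)]
  have y: "y t \<in> borel_measurable M" if "t \<in> {0..real n}" for t
    using obs that unfolding observation_def by blast
  have f: "periodic_L2 f" unfolding f_def[abs_def] by (rule periodic_L2_sum[OF A(1) \<phi>])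
  have I: "has_stochastic_integral M y (real n) f (\<lambda>\<omega>. \<Sum>j\<in>A. c j * J j \<omega>)"
    unfolding f_def[abs_def] using y A(1) J by (rule has_stochastic_integral_sum)
  have Sm: "S \<in> borel_measurable lebesgue" using S unfolding periodic_L2_def by simp
  have sq: "(LINT t|interval_lebesgue (real n). (f t)\<^sup>2) = (\<Sum>j\<in>A. (u j)\<^sup>2)"
  proof -
    have "inner_L2 f f = (\<Sum>j\<in>A. (c j)\<^sup>2)"
      unfolding f_def[abs_def] by (rule inner_L2_orthonormal_sum[OF on A])
    then show ?thesis using periodic_L2_interval(2)[OF f f, of n] n
      by (simp add: power2_eq_square c_def sum_distrib_left)
  qed
  have lin: "(\<Sum>j\<in>A. c j * J j \<omega>) - (LINT t|interval_lebesgue (real n). f t * S t)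
    = (\<Sum>j\<in>A. u j * ((J j \<omega> - real n * inner_L2 S (\<phi> j)) / sqrt (real n)))" for \<omega>
  proof -
    have "inner_L2 f S = (\<Sum>j\<in>A. c j * inner_L2 S (\<phi> j))"
      unfolding f_def[abs_def] inner_L2_commute[of S] by (rule inner_L2_sum_left[OF A(1) \<phi> S])
    then have "(\<Sum>j\<in>A. c j * J j \<omega>) - (LINT t|interval_lebesgue (real n). f t * S t)
      = (\<Sum>j\<in>A. c j * J j \<omega> - real n * (c j * inner_L2 S (\<phi> j)))"
      unfolding periodic_L2_interval(2)[OF f S] by (simp add: sum_subtractf sum_distrib_left)
    also have "\<dots> = (\<Sum>j\<in>A. u j * ((J j \<omega> - real n * inner_L2 S (\<phi> j)) / sqrt (real n)))"
      by (intro sum.cong refl) (simp add: c_def diff_divide_distrib algebra_simps)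
    finally show ?thesis .
  qed
  have "integrable (interval_lebesgue (real n)) (\<lambda>t. (S t)\<^sup>2)" "integrable (interval_lebesgue (real n)) (\<lambda>t. (f t)\<^sup>2)"
    using periodic_L2_interval(1)[OF S S, of n] periodic_L2_interval(1)[OF f f, of n] by (simp_all add: power2_eq_square)
  from nn_integral_exp_stochastic_integral[OF bm ou th obs I Sm this]
  show ?thesis unfolding sq lin .
qed

text \<open>Signs are arbitrary: since \<open>ennreal\<close> truncates at 0, this is subadditivity
  of the positive part.\<close>

lemma ennreal_add_le: "ennreal (a + b) \<le> ennreal a + ennreal b"
proof -
  have pos: "ennreal (max 0 c) = ennreal c" for c :: real by (simp add: max_def ennreal_neg)
  have "ennreal (a + b) \<le> ennreal (max 0 a + max 0 b)" by (intro ennreal_leI) auto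
  also have "\<dots> = ennreal (max 0 a) + ennreal (max 0 b)" by (rule ennreal_plus) auto
  finally show ?thesis unfolding pos .
qed

lemma nn_integral_exp_square_quarter_le:
  fixes Z :: "'a \<Rightarrow> real"
  assumes "prob_space M" "Z \<in> borel_measurable M"
    and "\<And>u. (\<integral>\<^sup>+\<omega>. ennreal (exp (u * Z \<omega>)) \<partial>M) \<le> ennreal (exp (1 / 2 * u\<^sup>2))"
  shows "(\<integral>\<^sup>+\<omega>. ennreal (exp (1 / 4 * (Z \<omega>)\<^sup>2)) \<partial>M) \<le> ennreal (sqrt 2)"
  using nn_integral_exp_sum_squares[OF assms(1), of "{()}" "\<lambda>_. Z"] assms(2,3) by simp

section \<open>The risk bound: absorption of the noise and summation over the models\<close>

theorem corollary2:
  fixes M :: "'a measure"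
    and n :: nat
    and \<theta> :: real
    and S :: "real \<Rightarrow> real"
    and w \<xi> y :: "real \<Rightarrow> 'a \<Rightarrow> real"
    and \<phi> :: "nat \<Rightarrow> real \<Rightarrow> real"
    and J :: "nat \<Rightarrow> 'a \<Rightarrow> real"
    and \<M> :: "nat set set"
    and l :: "nat set \<Rightarrow> real"
    and mhat :: "'a \<Rightarrow> nat set"
  assumes "n \<ge> 1"
    and "\<theta> \<le> 0"
    and "prob_space M"
    and "standard_brownian_motion M w"
    and "ornstein_uhlenbeck M \<theta> w \<xi>"
    and "periodic_L2 S"
    and "observation M (real n) S \<xi> y"
    and "orthonormal_system \<phi>"
    and "finite \<M>" and "\<M> \<noteq> {}"
    and "\<And>m. m \<in> \<M> \<Longrightarrow> finite m \<and> m \<subseteq> {1..}"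
    and "\<And>m. m \<in> \<M> \<Longrightarrow> l m \<ge> 1"
    and "\<And>j. j \<ge> 1 \<Longrightarrow> has_stochastic_integral M y (real n) (\<phi> j) (J j)"
    and "selects_model M 2 n \<phi> J \<M> l mhat"
  shows "(\<integral>\<^sup>+\<omega>. ennreal (normsq_L2 (\<lambda>t. S_hat n \<phi> J (mhat \<omega>) \<omega> t - S t)) \<partial>M)
           \<le> ennreal ((INF m\<in>\<M>. b_hat n \<phi> l S m) + 2 * tau0 \<M> l / real n)"
proof -
  note n = assms(1) and th = assms(2) and M = assms(3) and bm = assms(4) and ou = assms(5)
    and S = assms(6) and obs = assms(7) and on = assms(8) and finM = assms(9) and neM = assms(10)
    and models = assms(11) and l1 = assms(12) and J = assms(13) and sel = assms(14)
  interpret prob_space M by (rule M)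
  have n0: "real n > 0" using n by simp
  define s where "s j = inner_L2 S (\<phi> j)" for j
  define x where "x j \<omega> = (J j \<omega> - real n * s j) / sqrt (real n)" for j \<omega>
  define p where "p m = l m * real (card m)" for m
  define B where "B m = normsq_L2 (\<lambda>t. proj_on \<phi> S m t - S t)" for m
  have x: "x j \<in> borel_measurable M" if "j \<ge> 1" for j
  proof -
    have [measurable]: "J j \<in> borel_measurable M"
      using J[OF that] unfolding has_stochastic_integral_def by blast
    show ?thesis unfolding x_def[abs_def] by measurable
  qed
  have mgf: "(\<integral>\<^sup>+\<omega>. ennreal (exp (\<Sum>j\<in>A. u j * x j \<omega>)) \<partial>M) \<le> ennreal (exp (1 / 2 * (\<Sum>j\<in>A. (u j)\<^sup>2)))"
    if A: "finite A" "A \<subseteq> {1..}" for A u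
  proof -
    have "has_stochastic_integral M y (real n) (\<phi> j) (J j)" if "j \<in> A" for j
      using A that by (intro J) auto
    from nn_integral_exp_coefficient_noise[OF bm ou th obs S n on A this]
    show ?thesis unfolding x_def s_def .
  qed
  \<comment> \<open>The infimum over the finite family is attained, so a single comparison model is
    enough.\<close>
  obtain m where m: "m \<in> \<M>" and Inf: "b_hat n \<phi> l S m = (INF m\<in>\<M>. b_hat n \<phi> l S m)"
  proof -
    have "(INF m\<in>\<M>. b_hat n \<phi> l S m) = Min (b_hat n \<phi> l S ` \<M>)"
      using finM neM by (intro cInf_eq_Min) auto
    moreover have "Min (b_hat n \<phi> l S ` \<M>) \<in> b_hat n \<phi> l S ` \<M>" using finM neM by (intro Min_in) auto
    ultimately show thesis using that by (metis imageE)
  qed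
  define v where "v m' j = (if j \<in> m' then s j else 0) - (if j \<in> m then s j else 0)" for m' j
  define Z where "Z m' \<omega> = (\<Sum>j\<in>m \<union> m'. v m' j / sqrt (\<Sum>j\<in>m \<union> m'. (v m' j)\<^sup>2) * x j \<omega>)" for m' \<omega>
  define Q where "Q m' \<omega> = (\<Sum>j\<in>m'. (x j \<omega>)\<^sup>2)" for m' \<omega>
  \<comment> \<open>\<open>T1\<close> and \<open>T2\<close> are the quadratic noise terms minus the
    parts that the penalty absorbs; their positive parts appear later through
    \<open>ennreal\<close>. The threshold for Q is the larger one, as Q collects all dimensions of
    m'.\<close>
  define T1 where "T1 m' \<omega> = 3 / real n * (Q m' \<omega> - 6 * p m')" for m' \<omega>
  define T2 where "T2 m' \<omega> = 4 / real n * ((Z m' \<omega>)\<^sup>2 - 4 * p m')" for m' \<omega>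
  have U: "finite (m \<union> m')" "m \<union> m' \<subseteq> {1..}" if "m' \<in> \<M>" for m' using models m that by auto
  have Qm: "Q m' \<in> borel_measurable M" and Zm: "Z m' \<in> borel_measurable M" if "m' \<in> \<M>" for m'
    unfolding Q_def[abs_def] Z_def[abs_def] using U[OF that]
    by (intro borel_measurable_sum borel_measurable_power borel_measurable_times borel_measurable_const x; auto)+
  have T1m: "(\<lambda>\<omega>. ennreal (T1 m' \<omega>)) \<in> borel_measurable M"
    and T2m: "(\<lambda>\<omega>. ennreal (T2 m' \<omega>)) \<in> borel_measurable M" if "m' \<in> \<M>" for m'
    unfolding T1_def T2_def using Qm[OF that] Zm[OF that] by measurable
  have p0: "0 \<le> p m'" if "m' \<in> \<M>" for m' using l1[OF that] unfolding p_def by simp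

  have pointwise: "normsq_L2 (\<lambda>t. S_hat n \<phi> J (mhat \<omega>) \<omega> t - S t)
      \<le> b_hat n \<phi> l S m + (T1 (mhat \<omega>) \<omega> + T2 (mhat \<omega>) \<omega>)" and mhat: "mhat \<omega> \<in> \<M>" if "\<omega> \<in> space M" for \<omega>
  proof -
    define a where "a j = alpha_hat n J j \<omega>" for j
    define m' where "m' = mhat \<omega>"
    have arg: "is_arg_min (\<lambda>m. contrast n \<phi> J m (\<lambda>j. alpha_hat n J j \<omega>) \<omega> + penalty 2 n l m) (\<lambda>m. m \<in> \<M>) m'"
      using sel that unfolding selects_model_def m'_def by blast
    then have m': "m' \<in> \<M>" by (simp add: is_arg_min_def)
    then show "mhat \<omega> \<in> \<M>" by (simp add: m'_def)
    have c: "contrast n \<phi> J k (\<lambda>j. alpha_hat n J j \<omega>) \<omega> = - (\<Sum>j\<in>k. (a j)\<^sup>2)" if "k \<in> \<M>" for k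
      using models[OF that] unfolding a_def by (intro contrast_alpha_hat on) simp_all
    have "contrast n \<phi> J m' (\<lambda>j. alpha_hat n J j \<omega>) \<omega> + penalty 2 n l m'
        \<le> contrast n \<phi> J m (\<lambda>j. alpha_hat n J j \<omega>) \<omega> + penalty 2 n l m"
      using arg m unfolding is_arg_min_linorder by blast
    then have le: "penalty 2 n l m' - (\<Sum>j\<in>m'. (a j)\<^sup>2) \<le> penalty 2 n l m - (\<Sum>j\<in>m. (a j)\<^sup>2)"
      unfolding c[OF m'] c[OF m] by simp
    have aj: "a j = s j + x j \<omega> / sqrt (real n)" for j
      using n0 by (simp add: a_def alpha_hat_def x_def field_simps)
    have fin: "finite m" "finite m'" using models m m' by auto
    have Bessel: "(\<Sum>j\<in>m \<union> m'. (s j)\<^sup>2) \<le> normsq_L2 S"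
      unfolding s_def by (rule Bessel_inequality[OF on U[OF m'] S])
    have "normsq_L2 (\<lambda>t. S_hat n \<phi> J m' \<omega> t - S t)
      = normsq_L2 S - 2 * (\<Sum>j\<in>m'. a j * s j) + (\<Sum>j\<in>m'. (a j)\<^sup>2)"
      unfolding S_hat_def a_def s_def using models[OF m'] by (intro normsq_L2_orthonormal_diff on S) auto
    also have "\<dots> \<le> 3 * (normsq_L2 S - (\<Sum>j\<in>m. (s j)\<^sup>2)) + 2 * penalty 2 n l m - 2 * penalty 2 n l m'
        + (3 * Q m' \<omega> + 4 * (Z m' \<omega>)\<^sup>2) / real n"
      using penalised_selection_bound[OF fin n Bessel aj le] unfolding Q_def Z_def v_def .
    also have "normsq_L2 S - (\<Sum>j\<in>m. (s j)\<^sup>2) = B m"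
      unfolding B_def s_def using models[OF m] by (intro normsq_L2_proj_on_diff[symmetric] on S) auto
    finally have loss: "normsq_L2 (\<lambda>t. S_hat n \<phi> J m' \<omega> t - S t)
      \<le> 3 * B m + 2 * penalty 2 n l m - 2 * penalty 2 n l m' + (3 * Q m' \<omega> + 4 * (Z m' \<omega>)\<^sup>2) / real n" .
    have pm: "3 * B m + 2 * penalty 2 n l m \<le> b_hat n \<phi> l S m"
    proof -
      have "rho 2 * (p m / real n) \<le> tau1 * (p m / real n)"
        using p0[OF m] by (intro mult_right_mono rho_two_le_tau1) simp
      moreover have "b_hat n \<phi> l S m = 3 * B m + 2 * (tau1 * (p m / real n))"
        unfolding b_hat_def B_def p_def by (simp add: mult_ac)
      moreover have "penalty 2 n l m = rho 2 * (p m / real n)" unfolding penalty_def p_def ..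
      ultimately show ?thesis by linarith
    qed
    \<comment> \<open>34 = 3 * 6 + 4 * 4 is what the two thresholds take from the available 2 *
      32.\<close>
    have pm': "- 2 * penalty 2 n l m' \<le> - (34 * (p m' / real n))"
    proof -
      have "32 * (p m' / real n) \<le> rho 2 * (p m' / real n)"
        using p0[OF m'] by (intro mult_right_mono rho_two_ge) simp
      moreover have "0 \<le> p m' / real n" using p0[OF m'] by simp
      ultimately show ?thesis unfolding penalty_def p_def[symmetric] by linarith
    qed
    from loss pm pm' have "normsq_L2 (\<lambda>t. S_hat n \<phi> J m' \<omega> t - S t)
      \<le> b_hat n \<phi> l S m - 34 * (p m' / real n) + (3 * Q m' \<omega> + 4 * (Z m' \<omega>)\<^sup>2) / real n" by linarith
    also have "\<dots> = b_hat n \<phi> l S m + (T1 m' \<omega> + T2 m' \<omega>)"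
      unfolding T1_def T2_def using n0 by (simp add: field_simps)
    finally show "normsq_L2 (\<lambda>t. S_hat n \<phi> J (mhat \<omega>) \<omega> t - S t)
      \<le> b_hat n \<phi> l S m + (T1 (mhat \<omega>) \<omega> + T2 (mhat \<omega>) \<omega>)" unfolding m'_def .
  qed

  have I1: "(\<integral>\<^sup>+\<omega>. ennreal (T1 m' \<omega>) \<partial>M) \<le> ennreal (12 / real n * exp (- l m' * real (card m')))"
    if m': "m' \<in> \<M>" for m'
  proof -
    have f: "finite m'" "m' \<subseteq> {1..}" using models[OF m'] by auto
    have "(\<integral>\<^sup>+\<omega>. ennreal (exp (1 / 4 * Q m' \<omega>)) \<partial>M) \<le> ennreal (sqrt 2 ^ card m')"
      unfolding Q_def
    proof (rule nn_integral_exp_sum_squares[OF M f(1)])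
      show "x j \<in> borel_measurable M" if "j \<in> m'" for j using f that by (intro x) auto
    qed (rule mgf[OF f])
    then have "(\<integral>\<^sup>+\<omega>. ennreal (T1 m' \<omega>) \<partial>M)
        \<le> ennreal (4 * (3 / real n) * (exp (- (6 * p m') / 4) * sqrt 2 ^ card m'))"
      unfolding T1_def by (intro nn_integral_positive_part_le Qm[OF m']) auto
    also have "\<dots> \<le> ennreal (12 / real n * exp (- l m' * real (card m')))"
    proof (rule ennreal_leI)
      have "exp (- (6 * p m') / 4) * sqrt 2 ^ card m' \<le> exp (- l m' * real (card m'))"
        using sqrt_two_power_le[OF l1[OF m'], of "card m'"] by (simp add: p_def)
      then have "12 / real n * (exp (- (6 * p m') / 4) * sqrt 2 ^ card m') \<le> 12 / real n * exp (- l m' * real (card m'))"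
        by (rule mult_left_mono) simp
      then show "4 * (3 / real n) * (exp (- (6 * p m') / 4) * sqrt 2 ^ card m') \<le> 12 / real n * exp (- l m' * real (card m'))"
        by simp
    qed
    finally show ?thesis .
  qed

  have I2: "(\<integral>\<^sup>+\<omega>. ennreal (T2 m' \<omega>) \<partial>M) \<le> ennreal (24 / real n * exp (- l m' * real (card m')))"
    if m': "m' \<in> \<M>" for m'
  proof -
    let ?\<sigma> = "sqrt (\<Sum>j\<in>m \<union> m'. (v m' j)\<^sup>2)"
    have "(\<integral>\<^sup>+\<omega>. ennreal (exp (u * Z m' \<omega>)) \<partial>M) \<le> ennreal (exp (1 / 2 * u\<^sup>2))" for u
    proof -
      have "(\<Sum>j\<in>m \<union> m'. (u * (v m' j / ?\<sigma>))\<^sup>2) = u\<^sup>2 * ((\<Sum>j\<in>m \<union> m'. (v m' j)\<^sup>2) / ?\<sigma>\<^sup>2)"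
        by (simp only: power_mult_distrib power_divide sum_distrib_left sum_divide_distrib)
      \<comment> \<open>The normalised direction has norm 1, or 0 when the projections coincide and
        the division by 0 yields 0.\<close>
      also have "\<dots> \<le> u\<^sup>2 * 1"
        by (intro mult_left_mono) (auto simp: sum_nonneg divide_le_eq_1)
      finally have le: "exp (1 / 2 * (\<Sum>j\<in>m \<union> m'. (u * (v m' j / ?\<sigma>))\<^sup>2)) \<le> exp (1 / 2 * u\<^sup>2)" by simp
      have "(\<integral>\<^sup>+\<omega>. ennreal (exp (u * Z m' \<omega>)) \<partial>M) = (\<integral>\<^sup>+\<omega>. ennreal (exp (\<Sum>j\<in>m \<union> m'. (u * (v m' j / ?\<sigma>)) * x j \<omega>)) \<partial>M)"
        unfolding Z_def by (simp only: sum_distrib_left mult.assoc)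
      also have "\<dots> \<le> ennreal (exp (1 / 2 * (\<Sum>j\<in>m \<union> m'. (u * (v m' j / ?\<sigma>))\<^sup>2)))"
        by (rule mgf[OF U[OF m']])
      also have "\<dots> \<le> ennreal (exp (1 / 2 * u\<^sup>2))" by (rule ennreal_leI[OF le])
      finally show ?thesis .
    qed
    from nn_integral_exp_square_quarter_le[OF M Zm[OF m'] this]
    have "(\<integral>\<^sup>+\<omega>. ennreal (T2 m' \<omega>) \<partial>M) \<le> ennreal (4 * (4 / real n) * (exp (- (4 * p m') / 4) * sqrt 2))"
      unfolding T2_def by (intro nn_integral_positive_part_le borel_measurable_power Zm[OF m']) auto
    also have "\<dots> \<le> ennreal (24 / real n * exp (- l m' * real (card m')))"
    proof (rule ennreal_leI)
      \<comment> \<open>Turns 16 sqrt 2 into 24. The threshold 4 p at rate 1 / 4 already gives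
        e^{-p}, since a single direction costs sqrt 2 whatever the dimension.\<close>
      have "sqrt 2 \<le> (3 / 2 :: real)" by (rule real_le_lsqrt) (auto simp: power2_eq_square)
      then have "16 / real n * exp (- p m') * sqrt 2 \<le> 16 / real n * exp (- p m') * (3 / 2)"
        by (rule mult_left_mono) simp
      then show "4 * (4 / real n) * (exp (- (4 * p m') / 4) * sqrt 2) \<le> 24 / real n * exp (- l m' * real (card m'))"
        by (simp add: p_def mult_ac)
    qed
    finally show ?thesis .
  qed

  have B0: "0 \<le> b_hat n \<phi> l S m"
    unfolding b_hat_def using normsq_L2_nonneg[of "\<lambda>t. proj_on \<phi> S m t - S t"] p0[OF m] z_star_bounds
    by (auto simp: tau1_def p_def mult.commute intro!: add_nonneg_nonneg mult_nonneg_nonneg divide_nonneg_nonneg)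
  have "(\<integral>\<^sup>+\<omega>. ennreal (normsq_L2 (\<lambda>t. S_hat n \<phi> J (mhat \<omega>) \<omega> t - S t)) \<partial>M)
    \<le> (\<integral>\<^sup>+\<omega>. ennreal (b_hat n \<phi> l S m) + (\<Sum>m'\<in>\<M>. ennreal (T1 m' \<omega>) + ennreal (T2 m' \<omega>)) \<partial>M)"
  proof (rule nn_integral_mono)
    fix \<omega> assume \<omega>: "\<omega> \<in> space M"
    have "ennreal (normsq_L2 (\<lambda>t. S_hat n \<phi> J (mhat \<omega>) \<omega> t - S t))
        \<le> ennreal (b_hat n \<phi> l S m + (T1 (mhat \<omega>) \<omega> + T2 (mhat \<omega>) \<omega>))"
      by (rule ennreal_leI[OF pointwise[OF \<omega>]])
    also have "\<dots> \<le> ennreal (b_hat n \<phi> l S m) + (ennreal (T1 (mhat \<omega>) \<omega>) + ennreal (T2 (mhat \<omega>) \<omega>))"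
      by (rule order_trans[OF ennreal_add_le add_left_mono[OF ennreal_add_le]])
    \<comment> \<open>The random index is bounded by the sum over all models, whose terms are
      nonnegative after the truncation; only fixed indices are left to integrate.\<close>
    also have "\<dots> \<le> ennreal (b_hat n \<phi> l S m) + (\<Sum>m'\<in>\<M>. ennreal (T1 m' \<omega>) + ennreal (T2 m' \<omega>))"
      by (intro add_left_mono member_le_sum mhat[OF \<omega>] finM) simp
    finally show "ennreal (normsq_L2 (\<lambda>t. S_hat n \<phi> J (mhat \<omega>) \<omega> t - S t))
      \<le> ennreal (b_hat n \<phi> l S m) + (\<Sum>m'\<in>\<M>. ennreal (T1 m' \<omega>) + ennreal (T2 m' \<omega>))" .
  qed
  also have "\<dots> = ennreal (b_hat n \<phi> l S m)
      + (\<Sum>m'\<in>\<M>. (\<integral>\<^sup>+\<omega>. ennreal (T1 m' \<omega>) \<partial>M) + (\<integral>\<^sup>+\<omega>. ennreal (T2 m' \<omega>) \<partial>M))"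
  proof -
    have "(\<integral>\<^sup>+\<omega>. (\<Sum>m'\<in>\<M>. ennreal (T1 m' \<omega>) + ennreal (T2 m' \<omega>)) \<partial>M)
       = (\<Sum>m'\<in>\<M>. \<integral>\<^sup>+\<omega>. ennreal (T1 m' \<omega>) + ennreal (T2 m' \<omega>) \<partial>M)"
      by (intro nn_integral_sum borel_measurable_add T1m T2m)
    also have "\<dots> = (\<Sum>m'\<in>\<M>. (\<integral>\<^sup>+\<omega>. ennreal (T1 m' \<omega>) \<partial>M) + (\<integral>\<^sup>+\<omega>. ennreal (T2 m' \<omega>) \<partial>M))"
      by (intro sum.cong refl nn_integral_add T1m T2m)
    finally have s: "(\<integral>\<^sup>+\<omega>. (\<Sum>m'\<in>\<M>. ennreal (T1 m' \<omega>) + ennreal (T2 m' \<omega>)) \<partial>M)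
       = (\<Sum>m'\<in>\<M>. (\<integral>\<^sup>+\<omega>. ennreal (T1 m' \<omega>) \<partial>M) + (\<integral>\<^sup>+\<omega>. ennreal (T2 m' \<omega>) \<partial>M))" .
    show ?thesis unfolding s[symmetric]
      by (subst nn_integral_add) (auto simp: emeasure_space_1 intro!: borel_measurable_sum borel_measurable_add T1m T2m)
  qed
  also have "\<dots> \<le> ennreal (b_hat n \<phi> l S m) + (\<Sum>m'\<in>\<M>. ennreal (12 / real n * exp (- l m' * real (card m')))
      + ennreal (24 / real n * exp (- l m' * real (card m'))))"
    by (intro add_left_mono sum_mono add_mono I1 I2)
  also have "(\<Sum>m'\<in>\<M>. ennreal (12 / real n * exp (- l m' * real (card m')))
      + ennreal (24 / real n * exp (- l m' * real (card m')))) = (\<Sum>m'\<in>\<M>. ennreal (36 / real n * exp (- l m' * real (card m'))))"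
    by (intro sum.cong refl) (simp add: ennreal_plus[symmetric] distrib_right[symmetric] add_divide_distrib[symmetric] del: ennreal_plus)
  also have "\<dots> = ennreal (36 / real n * l_star \<M> l)"
    unfolding l_star_def sum_distrib_left by (rule sum_ennreal) simp
  also have "\<dots> \<le> ennreal (2 * tau0 \<M> l / real n)"
  proof (rule ennreal_leI)
    have L: "0 \<le> 32 / real n * l_star \<M> l" unfolding l_star_def by (simp add: sum_nonneg)
    have "32 / real n * l_star \<M> l * (9 / 8) \<le> 32 / real n * l_star \<M> l * (z_star / (z_star - 1))"
      by (rule mult_left_mono[OF z_star_quotient_ge L])
    then show "36 / real n * l_star \<M> l \<le> 2 * tau0 \<M> l / real n" by (simp add: tau0_def mult_ac)
  qed
  finally have "(\<integral>\<^sup>+\<omega>. ennreal (normsq_L2 (\<lambda>t. S_hat n \<phi> J (mhat \<omega>) \<omega> t - S t)) \<partial>M)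
      \<le> ennreal (b_hat n \<phi> l S m) + ennreal (2 * tau0 \<M> l / real n)" by (simp add: add_left_mono)
  also have "\<dots> = ennreal (b_hat n \<phi> l S m + 2 * tau0 \<M> l / real n)"
  proof (rule ennreal_plus[symmetric, OF B0])
    show "0 \<le> 2 * tau0 \<M> l / real n"
      using z_star_bounds unfolding tau0_def l_star_def by (simp add: sum_nonneg)
  qed
  finally show ?thesis unfolding Inf .
qed

end
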